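(* Let $E\le\mathrm{Homeo}_+(\mathbb{R})$ be finitely generated, locally moving with abelian germs, and FG-filtered. Then for any injective group homomorphism $\iota\colon E\to V$ into Thompson's group $V$, the resulting action of $E$ on the Cantor space $\mathfrak{C}$ is semiconjugate to the standard action of $E$ on $S^1=\mathbb{R}\cup\{\infty\}$; that is, there exists a continuous surjective $E$-equivariant map $\mathfrak{C}\to S^1$.
   Context: Actions are right actions. Thompson's group $V$ is the group of all homeomorphisms $h$ of $\mathfrak{C}=\{0,1\}^{\mathbb{N}}$ such that for every $\kappa\in\mathfrak{C}$ there exist a finite prefix $w$ of $\kappa$ and a finite string $u$ over $\{0,1\}$ with $(w\kappa')h=u\kappa'$ for all $\kappa'\in\mathfrak{C}$. $\mathrm{Homeo}_+(\mathbb{R})$ is the group of orientation-preserving homeomorphisms of $\mathbb{R}$. $S^1=\mathbb{R}\cup\{\infty\}$ is the one-point compactification of $\mathbb{R}$; a subgroup of $\mathrm{Homeo}_+(\mathbb{R})$ acts on it in the standard way, fixing $\infty$. The support $\mathrm{Supp}(f)$ is the set of points not fixed by $f$. For $E\le\mathrm{Homeo}_+(\mathbb{R})$ and $a<b$ in $\mathbb{R}$, let $E[a,b]=\{f\in E\mid \mathrm{Supp}(f)\subseteq[a,b]\}$ and let $E[a,b]'$ be the commutator subgroup of $E[a,b]$. $E$ is locally moving if for all $a<b$ in $\mathbb{R}$ the group $E[a,b]$ has no global fixed points in $(a,b)$. The group of germs of $E$ at $x\in\mathbb{R}$ is the quotient of $\mathrm{Stab}_E(x)$ by the normal subgroup of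 elements fixing pointwise an open neighborhood of $x$. $E$ has abelian germs if for all $x\in\mathbb{R}$ the group of germs of $E$ at $x$ is abelian. $E$ is FG-filtered if for all $a<b$ in $\mathbb{R}$ the group $E[a,b]'$ is contained in a finitely generated subgroup of $E[\ell,r]'$ for some $\ell<r$ in $\mathbb{R}$ with $\ell<a<b<r$. *)

theory Defs
  imports "HOL-Analysis.Analysis" "HOL-Algebra.Generated_Groups"
begin

text \<open>Actions are right actions: the image of a point under \<open>f\<close> is still written \<open>f x\<close>, but in
  both groups of homeomorphisms below the product of \<open>f\<close> and \<open>g\<close> means ``first \<open>f\<close>, then \<open>g\<close>''.\<close>

definition homeo_plus_real :: "(real \<Rightarrow> real) monoid" where
  "homeo_plus_real =
     \<lparr>carrier = {f. homeomorphic_map euclidean euclidean f \<and> strict_mono f},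
      mult = (\<lambda>f g. g \<circ> f), one = id\<rparr>"

text \<open>The topology on this type is the product topology of the discrete space \<^typ>\<open>bool\<close>.\<close>

type_synonym cantor = "nat \<Rightarrow> bool"

definition prepend :: "bool list \<Rightarrow> cantor \<Rightarrow> cantor" where
  "prepend w \<kappa> = (\<lambda>n. if n < length w then w ! n else \<kappa> (n - length w))"

definition is_prefix :: "bool list \<Rightarrow> cantor \<Rightarrow> bool" where
  "is_prefix w \<kappa> \<longleftrightarrow> (\<forall>i < length w. w ! i = \<kappa> i)"

definition thompson_V :: "(cantor \<Rightarrow> cantor) monoid" where
  "thompson_V =
     \<lparr>carrier = {h. homeomorphic_map euclidean euclidean h \<and>
        (\<forall>\<kappa>. \<exists>w u. is_prefix w \<kappa> \<and> (\<forall>\<kappa>'. h (prepend w \<kappa>') = prepend u \<kappa>'))},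
      mult = (\<lambda>f g. g \<circ> f), one = id\<rparr>"

text \<open>As usual for group actions, supports are not closed up.\<close>

definition Supp :: "(real \<Rightarrow> real) \<Rightarrow> real set" where
  "Supp f = {x. f x \<noteq> x}"

definition supported_in :: "(real \<Rightarrow> real) set \<Rightarrow> real \<Rightarrow> real \<Rightarrow> (real \<Rightarrow> real) set" where
  "supported_in E a b = {f \<in> E. Supp f \<subseteq> {a..b}}"

definition finitely_generated_subgroup :: "('a, 'b) monoid_scheme \<Rightarrow> 'a set \<Rightarrow> bool" where
  "finitely_generated_subgroup G H \<longleftrightarrow>
     (\<exists>S. finite S \<and> S \<subseteq> carrier G \<and> generate G S = H)"

definition locally_moving :: "(real \<Rightarrow> real) set \<Rightarrow> bool" where
  "locally_moving E \<longleftrightarrow>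
     (\<forall>a b. a < b \<longrightarrow> \<not> (\<exists>x \<in> {a<..<b}. \<forall>f \<in> supported_in E a b. f x = x))"

definition point_stabilizer :: "(real \<Rightarrow> real) set \<Rightarrow> real \<Rightarrow> (real \<Rightarrow> real) set" where
  "point_stabilizer E x = {f \<in> E. f x = x}"

definition trivial_germs :: "(real \<Rightarrow> real) set \<Rightarrow> real \<Rightarrow> (real \<Rightarrow> real) set" where
  "trivial_germs E x = {f \<in> E. \<exists>U. open U \<and> x \<in> U \<and> (\<forall>y \<in> U. f y = y)}"

definition germ_group :: "(real \<Rightarrow> real) set \<Rightarrow> real \<Rightarrow> (real \<Rightarrow> real) set monoid" where
  "germ_group E x =
     (homeo_plus_real\<lparr>carrier := point_stabilizer E x\<rparr>) Mod trivial_germs E x"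

definition abelian_germs :: "(real \<Rightarrow> real) set \<Rightarrow> bool" where
  "abelian_germs E \<longleftrightarrow> (\<forall>x. comm_group (germ_group E x))"

definition FG_filtered :: "(real \<Rightarrow> real) set \<Rightarrow> bool" where
  "FG_filtered E \<longleftrightarrow>
     (\<forall>a b. a < b \<longrightarrow>
       (\<exists>l r K. l < a \<and> b < r \<and>
          finitely_generated_subgroup homeo_plus_real K \<and>
          K \<subseteq> derived homeo_plus_real (supported_in E l r) \<and>
          derived homeo_plus_real (supported_in E a b) \<subseteq> K))"

text \<open>The circle is the one-point compactification of the line, with \<^term>\<open>None\<close> as the point at
  infinity; \<^term>\<open>map_option f\<close> is then the extension of \<open>f\<close> fixing infinity.\<close>

abbreviation circle :: "real option topology" where
  "circle \<equiv> Alexandroff_compactification euclidean"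


lemma group_homeo_plus_real: "group homeo_plus_real"
proof (rule groupI)
  fix f assume "f \<in> carrier homeo_plus_real"
  then have h: "homeomorphic_map euclidean euclidean f" and m: "strict_mono f"
    by (auto simp: homeo_plus_real_def)
  from h obtain g where g: "homeomorphic_maps euclidean euclidean f g"
    by (auto simp: homeomorphic_map_maps)
  then have fg: "f (g y) = y" and gf: "g (f y) = y" for y
    by (auto simp: homeomorphic_maps_def)
  have "strict_mono g"
    by (rule strict_monoI) (metis fg m strict_mono_less)
  moreover have "homeomorphic_map euclidean euclidean g"
    using g homeomorphic_map_maps homeomorphic_maps_sym by blast
  ultimately show "\<exists>g \<in> carrier homeo_plus_real. g \<otimes>\<^bsub>homeo_plus_real\<^esub> f = \<one>\<^bsub>homeo_plus_real\<^esub>"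
    using fg by (auto simp: homeo_plus_real_def fun_eq_iff)
qed (auto simp: homeo_plus_real_def comp_assoc strict_mono_o strict_mono_def
      intro: homeomorphic_map_compose)

lemma is_prefix_iff: "is_prefix w \<kappa> \<longleftrightarrow> (\<exists>\<kappa>'. \<kappa> = prepend w \<kappa>')"
proof
  assume "is_prefix w \<kappa>"
  then have "\<kappa> = prepend w (\<lambda>n. \<kappa> (n + length w))"
    by (auto simp: is_prefix_def prepend_def fun_eq_iff)
  then show "\<exists>\<kappa>'. \<kappa> = prepend w \<kappa>'" by blast
qed (auto simp: is_prefix_def prepend_def)

lemma prepend_append: "prepend (u @ v) \<kappa> = prepend u (prepend v \<kappa>)"
  by (auto simp: prepend_def fun_eq_iff nth_append)

lemma is_prefix_total:
  assumes "is_prefix u \<kappa>" "is_prefix v \<kappa>"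
  obtains t where "v = u @ t" | t where "u = v @ t"
proof -
  have "v = u @ drop (length u) v" if "length u \<le> length v"
    by (rule nth_equalityI)
      (use assms that in \<open>auto simp: is_prefix_def nth_append\<close>)
  moreover have "u = v @ drop (length v) u" if "length v \<le> length u"
    by (rule nth_equalityI)
      (use assms that in \<open>auto simp: is_prefix_def nth_append\<close>)
  ultimately show thesis
    using that by (meson linear)
qed

lemma group_thompson_V: "group thompson_V"
proof (rule groupI)
  fix f g assume f: "f \<in> carrier thompson_V" and g: "g \<in> carrier thompson_V"
  have "\<exists>w u. is_prefix w \<kappa> \<and> (\<forall>\<kappa>'. g (f (prepend w \<kappa>')) = prepend u \<kappa>')" for \<kappa>
  proof -
    obtain w u where w: "is_prefix w \<kappa>" "\<And>\<kappa>'. f (prepend w \<kappa>') = prepend u \<kappa>'"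
      using f by (auto simp: thompson_V_def) metis
    obtain v t where v: "is_prefix v (f \<kappa>)" "\<And>\<kappa>'. g (prepend v \<kappa>') = prepend t \<kappa>'"
      using g by (auto simp: thompson_V_def) metis
    obtain \<kappa>0 where k0: "\<kappa> = prepend w \<kappa>0" using w(1) is_prefix_iff by auto
    then have fk: "f \<kappa> = prepend u \<kappa>0" using w(2) by simp
    then have "is_prefix u (f \<kappa>)" using is_prefix_iff by auto
    then show ?thesis
    proof (rule is_prefix_total[OF _ v(1)])
      fix s assume s: "v = u @ s"
      obtain \<kappa>1 where k1: "f \<kappa> = prepend v \<kappa>1" using v(1) is_prefix_iff by auto
      have "prepend u \<kappa>0 = prepend u (prepend s \<kappa>1)"
        using fk k1 s prepend_append by metis
      then have "\<kappa>0 n = prepend s \<kappa>1 n" for n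
        by (drule_tac x = "n + length u" in fun_cong) (simp add: prepend_def)
      then have "\<kappa>0 = prepend s \<kappa>1" by (rule ext)
      then have "\<kappa> = prepend (w @ s) \<kappa>1"
        using k0 by (simp add: prepend_append)
      then have "is_prefix (w @ s) \<kappa>" using is_prefix_iff by auto
      moreover have "g (f (prepend (w @ s) \<kappa>')) = prepend t \<kappa>'" for \<kappa>'
        using w(2) v(2) s by (metis prepend_append)
      ultimately show ?thesis by blast
    next
      fix s assume s: "u = v @ s"
      have "g (f (prepend w \<kappa>')) = prepend (t @ s) \<kappa>'" for \<kappa>'
        using w(2) v(2) s by (metis prepend_append)
      then show ?thesis using w(1) by blast
    qed
  qed
  then show "f \<otimes>\<^bsub>thompson_V\<^esub> g \<in> carrier thompson_V"
    using f g by (auto simp: thompson_V_def intro: homeomorphic_map_compose)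
next
  fix f assume f: "f \<in> carrier thompson_V"
  then obtain g where g: "homeomorphic_maps euclidean euclidean f g"
    by (auto simp: thompson_V_def homeomorphic_map_maps)
  then have fg: "f (g y) = y" and gf: "g (f y) = y" for y
    by (auto simp: homeomorphic_maps_def)
  have "\<exists>w u. is_prefix w \<kappa> \<and> (\<forall>\<kappa>'. g (prepend w \<kappa>') = prepend u \<kappa>')" for \<kappa>
  proof -
    obtain w u where w: "is_prefix w (g \<kappa>)" "\<And>\<kappa>'. f (prepend w \<kappa>') = prepend u \<kappa>'"
      using f by (auto simp: thompson_V_def) metis
    have "is_prefix u \<kappa>" using w fg by (metis is_prefix_iff)
    moreover have "g (prepend u \<kappa>') = prepend w \<kappa>'" for \<kappa>'
      using w(2) gf by metis
    ultimately show ?thesis by blast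
  qed
  moreover have "homeomorphic_map euclidean euclidean g"
    using g homeomorphic_map_maps homeomorphic_maps_sym by blast
  ultimately have "g \<in> carrier thompson_V"
    by (auto simp: thompson_V_def)
  then show "\<exists>g \<in> carrier thompson_V. g \<otimes>\<^bsub>thompson_V\<^esub> f = \<one>\<^bsub>thompson_V\<^esub>"
    using fg by (auto simp: thompson_V_def fun_eq_iff)
next
  have "is_prefix [] \<kappa> \<and> (\<forall>\<kappa>'. id (prepend [] \<kappa>') = prepend [] \<kappa>')" for \<kappa>
    by (simp add: is_prefix_def)
  then show "\<one>\<^bsub>thompson_V\<^esub> \<in> carrier thompson_V"
    by (simp add: thompson_V_def) blast
qed (auto simp: thompson_V_def comp_assoc)

lemma normal_trivial_germs:
  assumes "subgroup E homeo_plus_real"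
  shows "trivial_germs E x \<lhd> homeo_plus_real\<lparr>carrier := point_stabilizer E x\<rparr>"
proof -
  interpret G: group homeo_plus_real by (rule group_homeo_plus_real)
  have mult: "f \<otimes>\<^bsub>homeo_plus_real\<^esub> g = g \<circ> f" and one: "\<one>\<^bsub>homeo_plus_real\<^esub> = id" for f g
    by (auto simp: homeo_plus_real_def)
  have E: "f \<in> carrier homeo_plus_real" if "f \<in> E" for f
    using assms that subgroup.mem_carrier by metis
  have inv: "(inv\<^bsub>homeo_plus_real\<^esub> f) (f y) = y" "f ((inv\<^bsub>homeo_plus_real\<^esub> f) y) = y"
    if "f \<in> E" for f y
    using G.r_inv[OF E[OF that]] G.l_inv[OF E[OF that]] by (auto simp: mult one fun_eq_iff)
  note sub = subgroup.m_closed[OF assms] subgroup.m_inv_closed[OF assms]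
    subgroup.one_closed[OF assms]
  have S: "subgroup (point_stabilizer E x) homeo_plus_real"
    by unfold_locales
      (use sub E in \<open>auto simp: point_stabilizer_def mult one, metis inv(1)\<close>)
  have T: "subgroup (trivial_germs E x) homeo_plus_real"
  proof
    fix f g assume fg: "f \<in> trivial_germs E x" "g \<in> trivial_germs E x"
    then obtain U V where "open U" "x \<in> U" "\<forall>y\<in>U. f y = y" "open V" "x \<in> V" "\<forall>y\<in>V. g y = y"
      by (auto simp: trivial_germs_def)
    then have "open (U \<inter> V) \<and> x \<in> U \<inter> V \<and> (\<forall>y \<in> U \<inter> V. g (f y) = y)" by auto
    then show "f \<otimes>\<^bsub>homeo_plus_real\<^esub> g \<in> trivial_germs E x"
      using fg sub(1) unfolding trivial_germs_def mult by fastforce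
  next
    fix f assume f: "f \<in> trivial_germs E x"
    then show "inv\<^bsub>homeo_plus_real\<^esub> f \<in> trivial_germs E x"
      using sub(2) unfolding trivial_germs_def by simp (metis inv(1))
  qed (use E sub(3) in \<open>auto simp: trivial_germs_def one\<close>)
  have TS: "trivial_germs E x \<subseteq> point_stabilizer E x"
    by (auto simp: trivial_germs_def point_stabilizer_def)
  interpret H: group "homeo_plus_real\<lparr>carrier := point_stabilizer E x\<rparr>"
    by (rule G.subgroup_imp_group[OF S])
  show ?thesis
    unfolding H.normal_inv_iff
  proof (intro conjI ballI)
    show "subgroup (trivial_germs E x) (homeo_plus_real\<lparr>carrier := point_stabilizer E x\<rparr>)"
      by (rule G.subgroup_incl[OF T S TS])
  next
    fix g f
    assume "g \<in> carrier (homeo_plus_real\<lparr>carrier := point_stabilizer E x\<rparr>)"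
      and f: "f \<in> trivial_germs E x"
    then have g: "g \<in> point_stabilizer E x" by simp
    then have gE: "g \<in> E" and gx: "g x = x" by (auto simp: point_stabilizer_def)
    obtain U where U: "open U" "x \<in> U" "\<forall>y\<in>U. f y = y" and fE: "f \<in> E"
      using f by (auto simp: trivial_germs_def)
    have "continuous_on UNIV g"
      using E[OF gE] homeomorphic_imp_continuous_map[of euclidean euclidean g]
      by (auto simp: homeo_plus_real_def)
    then have "open (g -` U)" using U(1) by (simp add: open_vimage)
    moreover have "x \<in> g -` U" using gx U by simp
    moreover have "\<forall>y \<in> g -` U. (g \<otimes>\<^bsub>homeo_plus_real\<^esub> f \<otimes>\<^bsub>homeo_plus_real\<^esub> inv\<^bsub>homeo_plus_real\<^esub> g) y = y"
      using U(3) inv(1)[OF gE] by (simp add: mult)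
    ultimately have "g \<otimes>\<^bsub>homeo_plus_real\<^esub> f \<otimes>\<^bsub>homeo_plus_real\<^esub> inv\<^bsub>homeo_plus_real\<^esub> g \<in> trivial_germs E x"
      using sub gE fE unfolding trivial_germs_def by blast
    then show "g \<otimes>\<^bsub>homeo_plus_real\<lparr>carrier := point_stabilizer E x\<rparr>\<^esub> f
        \<otimes>\<^bsub>homeo_plus_real\<lparr>carrier := point_stabilizer E x\<rparr>\<^esub>
        inv\<^bsub>homeo_plus_real\<lparr>carrier := point_stabilizer E x\<rparr>\<^esub> g \<in> trivial_germs E x"
      using G.m_inv_consistent[OF S g] by simp
  qed
qed

end

theory Submission
  imports Defs
begin

text \<open>Write \<open>E[a,b]'\<close> for the derived group of the elements of \<open>E\<close> supported in \<open>[a,b]\<close>. Every point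
  \<open>x\<close> of the Cantor space is sent to the place on the circle where \<open>E\<close> feels it: to the unique real
  \<open>p\<close> such that \<open>E[a,b]'\<close> moves \<open>x\<close> whenever \<open>a < p < b\<close>, and to infinity if all of these groups
  fix \<open>x\<close>. The whole proof consists in showing that this prescription makes sense and is continuous.

  The crux is that \<open>x\<close> cannot be moved by both \<open>E[a,b]'\<close> and \<open>E[c,d]'\<close> when \<open>b < c\<close> (lemma
  \<open>not_moves_disjoint\<close>). It rests on the dynamics of a single element \<open>F\<close> of Thompson's group. Such an
  \<open>F\<close> has only finitely many attracting periodic points, and for a suitable \<open>N > 0\<close> every point not
  fixed by \<open>F ^^ N\<close> has a forward orbit that accumulates at one of them (lemmas \<open>orbit_trichotomy\<close>
  and \<open>nonperiodic_points_converge\<close>). A group commuting with \<open>F\<close> permutes these finitely many points,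
  and germs of Thompson's group at a point commute, so commutators of elements that fix the
  attracting points and commute with \<open>F\<close> are trivial near them, hence trivial on the whole support of
  \<open>F ^^ N\<close>. Locally moving groups are close to simple: a subgroup that is normalised by
  \<open>E[a,b]'\<close> and moves a point of \<open>(a,b)\<close> contains \<open>E[c,d]'\<close> for all \<open>a < c < d < b\<close> (lemma
  \<open>normalized_subgroup_contains\<close>). Therefore all of
  \<open>E[a,b]'\<close> acts trivially on the support of \<open>F ^^ N\<close> for each \<open>F\<close> coming from an interval to the
  right of \<open>[a,b]\<close>. If \<open>E[a,b]'\<close> moves \<open>x\<close>, it follows that \<open>F ^^ N\<close> fixes the whole orbit of \<open>x\<close>
  under the group of that interval; the elements with this property form a nontrivial normal
  subgroup, and so, by the same near-simplicity, \<open>E[c,d]'\<close> fixes \<open>x\<close>.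

  Hence the intervals whose groups move \<open>x\<close> pairwise intersect, and if there are any, they have a
  common point \<open>p\<close>. If the group of some \<open>(a,b)\<close> around \<open>p\<close> fixed \<open>x\<close>, the stabiliser of \<open>x\<close> could
  carry \<open>p\<close> beyond any bound, contradicting the equivariance of the construction; this makes \<open>p\<close>
  unique and gives continuity at points with a finite image. Continuity at the points sent to infinity
  is where \<^const>\<open>FG_filtered\<close> enters: if every \<open>E[l,r]'\<close> fixes \<open>x\<close>, then all of its elements have trivial
  germs at \<open>x\<close>, and a finitely generated group of such elements fixes a common neighbourhood of \<open>x\<close>.
  The image is closed by compactness, and \<open>E\<close> has dense unbounded orbits on the line, so the map is
  onto.\<close>

section \<open>Local forms of maps of the Cantor space\<close>

definition agree :: "nat \<Rightarrow> cantor \<Rightarrow> cantor \<Rightarrow> bool" where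
  "agree n x y \<longleftrightarrow> (\<forall>i<n. x i = y i)"

lemma agree_refl [simp]: "agree n x x"
  by (simp add: agree_def)

lemma agree_sym: "agree n x y \<Longrightarrow> agree n y x"
  by (simp add: agree_def)

lemma agree_trans: "agree n x y \<Longrightarrow> agree n y z \<Longrightarrow> agree n x z"
  by (simp add: agree_def)

lemma agree_mono: "agree n x y \<Longrightarrow> m \<le> n \<Longrightarrow> agree m x y"
  by (simp add: agree_def)

lemma agree_all_imp_eq: "(\<And>n. \<exists>m\<ge>n. agree m x y) \<Longrightarrow> x = y"
  unfolding agree_def fun_eq_iff by (meson less_le_trans lessI)

lemma agree_iff_map: "agree n x y \<longleftrightarrow> map x [0..<n] = map y [0..<n]"
  by (auto simp: agree_def)

lemma open_cylinder: "open {y. agree n x y}"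
proof -
  have "open {y::cantor. y i = x i}" for i
  proof -
    have "continuous_on UNIV (\<lambda>y::cantor. y i)"
      by (rule continuous_on_product_coordinates)
    then have "open ((\<lambda>y::cantor. y i) -` {x i})"
      by (rule open_vimage[rotated]) (rule open_discrete)
    then show ?thesis by (simp add: vimage_def)
  qed
  then have "open (\<Inter>i\<in>{..<n}. {y. y i = x i})"
    by (intro open_INT) auto
  moreover have "(\<Inter>i\<in>{..<n}. {y. y i = x i}) = {y. agree n x y}"
    by (auto simp: agree_def)
  ultimately show ?thesis by simp
qed

lemma open_if_cylinders:
  assumes "\<And>x. x \<in> S \<Longrightarrow> \<exists>n. \<forall>y. agree n x y \<longrightarrow> y \<in> S"
  shows "open S"
proof (subst open_subopen, intro ballI)
  fix x assume "x \<in> S"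
  then obtain n where "\<forall>y. agree n x y \<longrightarrow> y \<in> S" using assms by blast
  then show "\<exists>T. open T \<and> x \<in> T \<and> T \<subseteq> S"
    using open_cylinder[of n x] by (intro exI[of _ "{y. agree n x y}"]) auto
qed

lemma compact_cantor: "compact (UNIV :: cantor set)"
proof -
  have "compact_space (euclidean :: bool topology)"
    by (simp add: compact_space_def finite_imp_compact)
  then have "compact_space (product_topology (\<lambda>_::nat. euclidean :: bool topology) UNIV)"
    by (simp only: compact_space_product_topology simp_thms ball_simps)
  then show ?thesis
    by (simp add: euclidean_product_topology compact_space_def)
qed

text \<open>Near \<open>x\<close> the map \<open>f\<close> replaces the first \<open>a\<close> letters of a point by the first \<open>b\<close> letters of
  \<open>f x\<close> and keeps the tail. Recording only the two lengths avoids all manipulation of finite words: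
  the words themselves are prefixes of \<open>x\<close> and \<open>f x\<close>.\<close>

definition local_form :: "(cantor \<Rightarrow> cantor) \<Rightarrow> cantor \<Rightarrow> nat \<Rightarrow> nat \<Rightarrow> bool" where
  "local_form f x a b \<longleftrightarrow>
     (\<forall>y. agree a x y \<longrightarrow> agree b (f x) (f y) \<and> (\<forall>i. f y (b + i) = y (a + i)))"

lemma local_form_extend:
  assumes "local_form f x a b"
  shows "local_form f x (a + c) (b + c)"
  unfolding local_form_def
proof (intro allI impI conjI)
  fix y assume y: "agree (a + c) x y"
  then have "agree a x y" by (rule agree_mono) simp
  with assms have b: "agree b (f x) (f y)" and t: "f y (b + i) = y (a + i)" for i
    by (auto simp: local_form_def)
  have tx: "f x (b + i) = x (a + i)" for i
    using assms by (auto simp: local_form_def)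
  show "agree (b + c) (f x) (f y)"
    unfolding agree_def
  proof (intro allI impI)
    fix i assume i: "i < b + c"
    show "f x i = f y i"
    proof (cases "i < b")
      case True
      then show ?thesis using b by (simp add: agree_def)
    next
      case False
      then obtain j where "i = b + j" using le_Suc_ex not_less by blast
      then show ?thesis using i y by (simp add: t tx agree_def)
    qed
  qed
  show "f y (b + c + i) = y (a + c + i)" for i
    using t[of "c + i"] by (simp add: add.assoc)
qed

lemma local_form_comp:
  assumes "local_form f x a b" "local_form g (f x) b c"
  shows "local_form (g \<circ> f) x a c"
  using assms by (auto simp: local_form_def)

lemma local_form_move:
  assumes "local_form f x a b" "agree a x y"
  shows "local_form f y a b"
  using assms unfolding local_form_def by (meson agree_sym agree_trans)

lemma local_form_inv:
  assumes "bij f" "local_form f x a b"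
  shows "local_form (inv_into UNIV f) (f x) b a"
  unfolding local_form_def
proof (intro allI impI)
  fix y assume y: "agree b (f x) y"
  define w where "w i = (if i < a then x i else y (b + (i - a)))" for i
  have xw: "agree a x w" by (simp add: agree_def w_def)
  with assms(2) have b: "agree b (f x) (f w)" and t: "f w (b + i) = w (a + i)" for i
    by (auto simp: local_form_def)
  have "f w i = y i" for i
  proof (cases "i < b")
    case True
    then show ?thesis using b y by (simp add: agree_def)
  next
    case False
    then obtain j where "i = b + j" using le_Suc_ex not_less by blast
    then show ?thesis by (simp add: t w_def)
  qed
  then have "f w = y" by (rule ext)
  then have "inv_into UNIV f y = w" "inv_into UNIV f (f x) = x"
    using bij_is_inj[OF assms(1)] by auto
  then show "agree a (inv_into UNIV f (f x)) (inv_into UNIV f y) \<and>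
      (\<forall>i. inv_into UNIV f y (a + i) = y (b + i))"
    using xw by (simp add: w_def)
qed

lemma local_form_agree:
  assumes "local_form f x a b"
  shows "\<exists>k. \<forall>y. agree k x y \<longrightarrow> agree n (f x) (f y)"
proof (intro exI allI impI)
  fix y assume "agree (a + n) x y"
  then have "agree (b + n) (f x) (f y)"
    using local_form_extend[OF assms, of n] by (auto simp: local_form_def)
  then show "agree n (f x) (f y)" by (rule agree_mono) simp
qed

text \<open>Both composites replace the first \<open>a + c\<close> letters of \<open>y\<close> by the first \<open>b + d\<close> letters of the common fixed
  point \<open>x\<close>, because lengthening the prefixes lets the two local forms be composed in either order.
  Thus germs of Thompson's group at a point commute.\<close>

lemma local_form_commute:
  assumes "local_form f x a b" "f x = x" "local_form g x c d" "g x = x" "agree (a + c) x y"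
  shows "f (g y) = g (f y)"
proof -
  have *: "agree (d' + b') x (g' (f' y)) \<and> (\<forall>i. g' (f' y) (d' + b' + i) = y (a' + c' + i))"
    if "local_form f' x a' b'" "f' x = x" "local_form g' x c' d'" "g' x = x" "agree (a' + c') x y"
    for f' g' a' b' c' d'
  proof -
    have "local_form (g' \<circ> f') x (a' + c') (d' + b')"
      using local_form_comp[OF local_form_extend[OF that(1), of c'], of g' "d' + b'"]
        local_form_extend[OF that(3), of b'] that(2) by (simp add: add.commute)
    then show ?thesis using that by (auto simp: local_form_def)
  qed
  have 1: "agree (d + b) x (g (f y))" "g (f y) (d + b + i) = y (a + c + i)" for i
    using *[OF assms] by auto
  have 2: "agree (d + b) x (f (g y))" "f (g y) (d + b + i) = y (a + c + i)" for i
    using *[OF assms(3,4,1,2)] assms(5) by (auto simp: add.commute)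
  have "f (g y) i = g (f y) i" for i
  proof (cases "i < d + b")
    case True
    then show ?thesis using 1(1) 2(1) by (simp add: agree_def)
  next
    case False
    then obtain j where "i = d + b + j" using le_Suc_ex not_less by blast
    then show ?thesis by (simp add: 1(2) 2(2))
  qed
  then show ?thesis by (rule ext)
qed

lemma thompson_V_bij: "f \<in> carrier thompson_V \<Longrightarrow> bij f"
  unfolding thompson_V_def
  by (auto simp: homeomorphic_map_maps homeomorphic_maps_def intro!: bij_betw_byWitness)

lemma thompson_V_local_form:
  assumes "f \<in> carrier thompson_V"
  shows "\<exists>a b. local_form f x a b"
proof -
  obtain w u where w: "is_prefix w x" "\<And>z. f (prepend w z) = prepend u z"
    using assms by (auto simp: thompson_V_def) metis
  have "y = prepend w (\<lambda>i. y (length w + i))" if "agree (length w) x y" for y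
    using that w(1) by (auto simp: agree_def is_prefix_def prepend_def fun_eq_iff)
  then have "f y = prepend u (\<lambda>i. y (length w + i))" if "agree (length w) x y" for y
    using w(2) that by metis
  then have "local_form f x (length w) (length u)"
    unfolding local_form_def by (simp add: agree_def prepend_def)
  then show ?thesis by blast
qed

text \<open>A uniform bound on the prefixes needed to describe \<open>f\<close>, on both sides; it serves \<open>f\<close> and its
  inverse alike.\<close>

definition table_depth :: "(cantor \<Rightarrow> cantor) \<Rightarrow> nat \<Rightarrow> bool" where
  "table_depth f m \<longleftrightarrow> (\<forall>x. \<exists>a\<le>m. \<exists>b\<le>m. local_form f x a b)"

text \<open>The cylinders on which the local forms are valid cover the compact Cantor space.\<close>

lemma thompson_V_table_depth:
  assumes "f \<in> carrier thompson_V"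
  obtains m where "table_depth f m"
proof -
  obtain a b where ab: "\<And>x. local_form f x (a x) (b x)"
    using thompson_V_local_form[OF assms] by metis
  obtain C where C: "finite C" "(\<Union>x\<in>C. {y. agree (a x) x y}) = UNIV"
    using compactE_image[OF compact_cantor, of UNIV "\<lambda>x. {y. agree (a x) x y}"] open_cylinder
    by (metis (no_types, lifting) UNIV_I UN_I agree_refl mem_Collect_eq subsetI top.extremum_uniqueI)
  define m where "m = Max (insert 0 (a ` C \<union> b ` C))"
  have m: "a x \<le> m" "b x \<le> m" if "x \<in> C" for x
    using that C(1) by (auto simp: m_def)
  have "\<exists>i\<le>m. \<exists>j\<le>m. local_form f y i j" for y
  proof -
    have "y \<in> (\<Union>x\<in>C. {y. agree (a x) x y})" using C(2) by simp
    then obtain x where "x \<in> C" "agree (a x) x y" by auto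
    then show ?thesis using m local_form_move[OF ab] by blast
  qed
  then show ?thesis using that by (auto simp: table_depth_def)
qed

section \<open>Contracting periodic points\<close>

lemma ex_common_multiple:
  assumes "finite S" "\<And>s. s \<in> S \<Longrightarrow> \<exists>n>0. R s n"
    and mult: "\<And>s n k. R s n \<Longrightarrow> 0 < k \<Longrightarrow> R s (n * k)"
  shows "\<exists>n>0. \<forall>s\<in>S. R s (n::nat)"
  using assms(1,2)
proof (induction S)
  case empty
  then show ?case by auto
next
  case (insert s S)
  obtain n where n: "n > 0" "\<forall>s\<in>S. R s n" using insert by auto
  obtain k where k: "k > 0" "R s k" using insert by auto
  have "R s (n * k)" using mult[OF k(2) n(1)] by (simp add: mult.commute)
  then show ?case using n k mult by (intro exI[of _ "n * k"]) auto
qed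

lemma funpow_fixed: "f x = x \<Longrightarrow> (f ^^ n) x = x"
  by (induction n) auto

lemma funpow_fixed_mult: "(f ^^ n) x = x \<Longrightarrow> (f ^^ (n * k)) x = x"
  by (metis funpow_fixed funpow_mult mult.commute)

lemma funpow_comm_apply: "(f ^^ i) ((f ^^ j) x) = (f ^^ j) ((f ^^ i) x)"
  by (metis add.commute comp_apply funpow_add)

lemma funpow_fixed_iterate:
  assumes "bij f"
  shows "(f ^^ n) ((f ^^ i) x) = (f ^^ i) x \<longleftrightarrow> (f ^^ n) x = x"
  using bij_is_inj[OF bij_fn[OF assms, of i]] by (metis funpow_comm_apply injD)

lemma contraction_iterate:
  assumes "g p = p" "local_form g p a b" "a < b" "agree a p y"
  shows "agree (a + r) p ((g ^^ r) y)"
proof (induction r)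
  case (Suc r)
  have "agree (b + r) p (g ((g ^^ r) y))"
    using local_form_extend[OF assms(2), of r] Suc assms(1) by (auto simp: local_form_def)
  then show ?case using agree_mono assms(3) by simp
qed (use assms in simp)

text \<open>The contraction principle: the iterates of \<open>x\<close> agree on longer and longer prefixes, and the
  point \<open>p\<close> they define is fixed.\<close>

lemma contraction_fixed_point:
  assumes g: "local_form g x a b" "a < b" and x: "agree a x (g x)"
  obtains p where "g p = p" "local_form g p a b" "agree b (g x) p"
proof -
  define s where "s r = (g ^^ r) x" for r
  have step: "agree (b + r) (g y) (g z)" if "agree a x y" "agree (a + r) y z" for y z r
    using local_form_extend[OF local_form_move[OF g(1) that(1)], of r] that(2)
    by (simp add: local_form_def)
  have consec: "agree a x (s r) \<and> agree (a + r) (s r) (s (Suc r))" for r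
  proof (induction r)
    case 0
    then show ?case using x by (simp add: s_def)
  next
    case (Suc r)
    then have "agree (b + r) (s (Suc r)) (s (Suc (Suc r)))" using step by (simp add: s_def)
    moreover have "agree a x (s (Suc r))"
      using Suc agree_trans agree_mono le_add1 by blast
    ultimately show ?case using agree_mono[of "b + r" _ _ "a + Suc r"] g(2) by auto
  qed
  have tail: "agree (a + r) (s r) (s (r + k))" for r k
  proof (induction k)
    case (Suc k)
    have "agree (a + r) (s (r + k)) (s (Suc (r + k)))"
      using agree_mono consec by (metis add.assoc le_add1)
    then show ?case using Suc agree_trans by (metis add_Suc_right)
  qed simp
  \<comment> \<open>The letter at position \<open>i\<close> no longer changes from the iterate \<open>Suc i\<close> on, since \<open>i < a + Suc i\<close>.\<close>
  define p where "p i = s (Suc i) i" for i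
  have sp: "agree (a + r) (s r) p" for r
    unfolding agree_def
  proof (intro allI impI)
    fix i assume i: "i < a + r"
    show "s r i = p i"
    proof (cases "Suc i \<le> r")
      case True
      then show ?thesis using tail[of "Suc i" "r - Suc i"] by (simp add: agree_def p_def)
    next
      case False
      then show ?thesis using tail[of r "Suc i - r"] i by (simp add: agree_def p_def)
    qed
  qed
  have "agree (b + r) (g (s r)) (g p)" for r
    using step consec sp by blast
  then have "agree (a + Suc r) (s (Suc r)) (g p)" for r
    using agree_mono[of "b + r" _ _ "a + Suc r"] g(2) by (simp add: s_def)
  then have "agree (a + Suc r) (g p) p" for r
    using sp agree_trans agree_sym by blast
  then have fix_p: "g p = p"
    by (intro agree_all_imp_eq) (metis le_add2 le_SucI add_Suc_right)
  have xp: "agree a x p" using sp[of 0] by (simp add: s_def)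
  then have "agree b (g x) (g p)" using g(1) by (simp add: local_form_def)
  then show ?thesis using that local_form_move[OF g(1) xp] fix_p by simp
qed

text \<open>The periodic points whose contraction is already visible on the cylinder of depth \<open>m\<close>. Fixing
  the depth makes the set finite, since each such cylinder contains at most one of them.\<close>

definition contracting_at :: "(cantor \<Rightarrow> cantor) \<Rightarrow> nat \<Rightarrow> cantor set" where
  "contracting_at f m = {p. \<exists>n>0. \<exists>b>m. (f ^^ n) p = p \<and> local_form (f ^^ n) p m b}"

text \<open>The iterates of \<open>q\<close> under the contraction at \<open>p\<close> tend to \<open>p\<close>, but \<open>q\<close> is periodic.\<close>

lemma contracting_at_unique:
  assumes "p \<in> contracting_at f m" "q \<in> contracting_at f m" "agree m p q"
  shows "p = q"
proof -
  obtain n b where n: "n > 0" "b > m" "(f ^^ n) p = p" "local_form (f ^^ n) p m b"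
    using assms by (auto simp: contracting_at_def)
  obtain k where k: "k > 0" "(f ^^ k) q = q"
    using assms by (auto simp: contracting_at_def)
  have "agree (m + k * r) p q" for r
  proof -
    have "((f ^^ n) ^^ (k * r)) q = q"
      using funpow_fixed_mult[OF k(2), of "r * n"] by (simp add: funpow_mult mult_ac)
    then show ?thesis using contraction_iterate[OF n(3,4,2) assms(3), of "k * r"] by simp
  qed
  moreover have "r \<le> m + k * r" for r using k(1) by (simp add: trans_le_add2)
  ultimately show ?thesis using agree_all_imp_eq by blast
qed

lemma finite_contracting_at: "finite (contracting_at f m)"
proof (rule inj_on_finite)
  show "inj_on (\<lambda>x. map x [0..<m]) (contracting_at f m)"
    using contracting_at_unique by (auto intro!: inj_onI simp: agree_iff_map)
  show "(\<lambda>x. map x [0..<m]) ` contracting_at f m \<subseteq> {xs. set xs \<subseteq> UNIV \<and> length xs = m}" by auto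
qed (rule finite_lists_length_eq, simp)

section \<open>Orbits of an element of Thompson's group\<close>

lemma finite_cylinders: "finite ((\<lambda>x::cantor. map x [0..<m]) ` X)"
proof (rule finite_subset)
  show "(\<lambda>x::cantor. map x [0..<m]) ` X \<subseteq> {xs. set xs \<subseteq> UNIV \<and> length xs = m}" by auto
qed (rule finite_lists_length_eq, simp)

text \<open>Along the orbit of \<open>y\<close> let the height \<open>h k\<close> count the letters gained minus the letters lost in the
  first \<open>k\<close> steps. As long as the height stays at least \<open>h i\<close>, the iterates only look at the first \<open>m\<close>
  letters of the \<open>i\<close>-th point, so they have a local form there that is controlled by the heights.

  If the heights are bounded below, two of the infinitely many times of future minimal height
  see the same \<open>m\<close> letters. Between these times an iterate maps a cylinder of depth \<open>m\<close> into itself: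
  it is the identity there if no letters were gained, and a contraction otherwise. If the heights are
  unbounded below, the same argument backwards in time, at the strict new minima, shows that some
  point of the orbit shares arbitrarily long prefixes with an attracting periodic point of the
  inverse, so it is that point.\<close>

lemma orbit_trichotomy:
  assumes bij: "bij f" and m: "table_depth f m"
  shows "(\<exists>i n p. n > 0 \<and> p \<in> contracting_at f m \<and> (f ^^ n) p = p \<and>
            (\<forall>r. agree r p (((f ^^ n) ^^ r) ((f ^^ i) y)))) \<or>
         (\<exists>i n. n > 0 \<and> (\<forall>z. agree m ((f ^^ i) y) z \<longrightarrow> (f ^^ n) z = z)) \<or>
         (\<exists>i. (f ^^ i) y \<in> contracting_at (inv_into UNIV f) m)"
proof -
  obtain a b where ab: "\<And>x. a x \<le> m" "\<And>x. b x \<le> m" "\<And>x. local_form f x (a x) (b x)"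
    using m unfolding table_depth_def by metis
  define s where "s i = (f ^^ i) y" for i
  define h where "h k = (\<Sum>i<k. int (b (s i)) - int (a (s i)))" for k
  have h_Suc: "h (Suc k) = h k + int (b (s k)) - int (a (s k))" for k by (simp add: h_def)
  \<comment> \<open>Here \<open>c + h (i + l)\<close> is the length of the prefix under control after \<open>l\<close> steps.\<close>
  have seg: "local_form (f ^^ k) (s i) (nat (c + h i)) (nat (c + h (i + k)))"
    if "\<forall>l<k. int m \<le> c + h (i + l)" for c i k
    using that
  proof (induction k)
    case 0
    then show ?case by (simp add: local_form_def)
  next
    case (Suc k)
    define e where "e = nat (c + h (i + k)) - a (s (i + k))"
    have c: "int m \<le> c + h (i + k)" using Suc.prems by simp
    with ab(1)[of "s (i + k)"] have e: "nat (c + h (i + k)) = a (s (i + k)) + e"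
      by (simp add: e_def)
    have "nat (c + h (i + Suc k)) = b (s (i + k)) + e"
      using c ab(1)[of "s (i + k)"] by (simp add: e_def h_Suc)
    moreover have "(f ^^ k) (s i) = s (i + k)"
      by (simp add: s_def funpow_add funpow_comm_apply)
    ultimately show ?case
      using local_form_comp[of "f ^^ k" "s i" _ _ f] Suc e
        local_form_extend[OF ab(3), of "s (i + k)" e] by (simp add: comp_def)
  qed
  have s_add: "(f ^^ k) (s i) = s (i + k)" for i k
    by (simp add: s_def funpow_add funpow_comm_apply)
  show ?thesis
  proof (cases "\<exists>c. \<forall>i. c \<le> h i")
    case True
    then obtain c where c: "\<And>i. c \<le> h i" by blast
    define F where "F = {i. \<forall>j\<ge>i. h i \<le> h j}"
    have "\<exists>i\<ge>i0. i \<in> F" for i0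
    proof -
      obtain i where i: "i \<ge> i0" "\<And>j. j \<ge> i0 \<Longrightarrow> nat (h i - c) \<le> nat (h j - c)"
        using ex_has_least_nat[of "\<lambda>i. i \<ge> i0" i0 "\<lambda>i. nat (h i - c)"] by blast
      have "h i \<le> h j" if "j \<ge> i" for j
      proof -
        have "nat (h i - c) \<le> nat (h j - c)" using i that by simp
        then show ?thesis using c[of i] c[of j] by simp
      qed
      then show ?thesis using i(1) by (auto simp: F_def)
    qed
    then have "infinite F" by (meson infinite_nat_iff_unbounded_le)
    moreover have "finite ((\<lambda>j. map (s j) [0..<m]) ` F)"
      using finite_cylinders[of m "s ` F"] by (simp only: image_image)
    ultimately obtain i where i: "i \<in> F"
      and inf: "infinite {j \<in> F. map (s j) [0..<m] = map (s i) [0..<m]}"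
      using pigeonhole_infinite by blast
    then obtain j where "j > i" "map (s j) [0..<m] = map (s i) [0..<m]"
      unfolding infinite_nat_iff_unbounded by blast
    then have j: "j > i" "agree m (s i) (s j)" unfolding agree_iff_map by simp_all
    define n where "n = j - i"
    define d where "d = nat (int m - h i + h j)"
    have "h i \<le> h j" using i j(1) by (simp add: F_def)
    then have d: "m \<le> d" by (simp add: d_def)
    have lf: "local_form (f ^^ n) (s i) m d"
      using seg[of n "int m - h i" i] i j(1) by (simp add: F_def n_def d_def)
    have sj: "(f ^^ n) (s i) = s j" using j(1) by (simp add: s_add n_def)
    have n: "n > 0" using j(1) by (simp add: n_def)
    show ?thesis
    proof (cases "d = m")
      case True
      have "(f ^^ n) z = z" if z: "agree m (s i) z" for z
      proof
        fix k
        have *: "agree m (s j) ((f ^^ n) z)" "(f ^^ n) z (m + l) = z (m + l)" for l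
          using lf z True sj by (auto simp: local_form_def)
        show "(f ^^ n) z k = z k"
        proof (cases "k < m")
          case True
          then show ?thesis using *(1) j(2) z by (simp add: agree_def)
        next
          case False
          then show ?thesis using *(2)[of "k - m"] by simp
        qed
      qed
      then show ?thesis using n unfolding s_def by blast
    next
      case False
      then have d: "m < d" using d by simp
      have "agree m (s i) ((f ^^ n) (s i))" using j(2) sj by simp
      from contraction_fixed_point[OF lf d this] obtain p
        where p: "(f ^^ n) p = p" "local_form (f ^^ n) p m d" "agree d (s j) p"
        unfolding sj .
      have "agree m (s j) p" using agree_mono[OF p(3)] d by simp
      then have "agree m p (s i)" using j(2) by (metis agree_sym agree_trans)
      then have "agree (m + r) p (((f ^^ n) ^^ r) (s i))" for r
        by (rule contraction_iterate[OF p(1,2) d])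
      then have "agree r p (((f ^^ n) ^^ r) (s i))" for r
        by (rule agree_mono) simp
      moreover have "p \<in> contracting_at f m"
        using n p d unfolding contracting_at_def by blast
      ultimately show ?thesis using n p(1) unfolding s_def by blast
    qed
  next
    case False
    then have low: "\<exists>i. h i < c" for c by (meson not_le)
    define F where "F = {j. \<forall>l<j. h j < h l}"
    have "\<exists>j\<ge>i0. j \<in> F" for i0
    proof -
      obtain k where k: "h k < Min (h ` {..i0})" using low by blast
      define j where "j = (LEAST j. h j < Min (h ` {..i0}))"
      have j: "h j < Min (h ` {..i0})" unfolding j_def using k by (rule LeastI)
      have j': "Min (h ` {..i0}) \<le> h l" if "l < j" for l
        using not_less_Least[OF that[unfolded j_def]] by (simp only: not_less)
      have "j > i0"
      proof (rule ccontr)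
        assume "\<not> j > i0"
        then have "Min (h ` {..i0}) \<le> h j" by simp
        then show False using j by simp
      qed
      moreover have "h j < h l" if "l < j" for l using j j'[OF that] by (rule less_le_trans)
      ultimately show ?thesis by (auto simp: F_def intro!: exI[of _ j])
    qed
    then have "infinite F" by (meson infinite_nat_iff_unbounded_le)
    moreover have "finite ((\<lambda>j. map (s j) [0..<m]) ` F)"
      using finite_cylinders[of m "s ` F"] by (simp only: image_image)
    ultimately obtain i where i: "i \<in> F"
      and inf: "infinite {j \<in> F. map (s j) [0..<m] = map (s i) [0..<m]}"
      using pigeonhole_infinite by blast
    have ex: "\<exists>p \<in> contracting_at (inv_into UNIV f) m.
        agree m p (s i) \<and> agree (nat (int m + h i - h j)) (s i) p"
      if j: "j \<in> F" "j > i" "agree m (s i) (s j)" for j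
    proof -
      define n where "n = j - i"
      define d where "d = nat (int m + h i - h j)"
      have "h j < h i" using j by (simp add: F_def)
      then have d: "m < d" by (simp add: d_def)
      have "\<forall>l<n. h j \<le> h (i + l)"
        using j(1) by (auto simp: F_def n_def intro: less_imp_le)
      then have lf: "local_form (f ^^ n) (s i) d m"
        using seg[of n "int m - h j" i] j(2) by (simp add: n_def d_def algebra_simps)
      have sj: "(f ^^ n) (s i) = s j" using j(2) by (simp add: s_add n_def)
      have g: "local_form (inv_into UNIV f ^^ n) (s j) m d" "(inv_into UNIV f ^^ n) (s j) = s i"
        using local_form_inv[OF bij_fn[OF bij] lf] sj inv_fn[OF bij, of n]
          inv_f_f[OF bij_is_inj[OF bij_fn[OF bij, of n]], of "s i"] by auto
      obtain p where p: "(inv_into UNIV f ^^ n) p = p" "local_form (inv_into UNIV f ^^ n) p m d"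
          "agree d (s i) p"
        using contraction_fixed_point[OF g(1) d] g(2) j(3) agree_sym by metis
      moreover have "agree m p (s i)"
        using p(3) d agree_mono agree_sym by (meson less_imp_le)
      moreover have "n > 0" using j by (simp add: n_def)
      ultimately show ?thesis using d unfolding contracting_at_def d_def by blast
    qed
    have later: "\<exists>j\<in>F. j > k \<and> agree m (s i) (s j)" for k
    proof -
      obtain j where "j > k" "j \<in> F" "map (s j) [0..<m] = map (s i) [0..<m]"
        using inf unfolding infinite_nat_iff_unbounded by blast
      then show ?thesis unfolding agree_iff_map by auto
    qed
    obtain j where "j \<in> F" "j > i" "agree m (s i) (s j)" using later by blast
    then obtain p where p: "p \<in> contracting_at (inv_into UNIV f) m" "agree m p (s i)"
      using ex[of j] by auto
    \<comment> \<open>All these contractions have the same fixed point \<open>p\<close>, and \<open>s i\<close> is the image of a point of the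
      cylinder under contractions of unbounded strength.\<close>
    have "\<exists>r\<ge>N. agree r (s i) p" for N
    proof -
      obtain k where k: "h k < h i - int N" using low by blast
      obtain j where j: "j \<in> F" "j > max i k" "agree m (s i) (s j)" using later by blast
      then obtain q where q: "q \<in> contracting_at (inv_into UNIV f) m" "agree m q (s i)"
        "agree (nat (int m + h i - h j)) (s i) q" using ex[of j] by auto
      have "q = p" using contracting_at_unique p q agree_sym agree_trans by metis
      moreover have "h j < h k" using j by (simp add: F_def)
      then have "N \<le> nat (int m + h i - h j)" using k by simp
      ultimately show ?thesis using q(3) by blast
    qed
    then have "s i = p" by (rule agree_all_imp_eq)
    then show ?thesis using p(1) unfolding s_def by blast
  qed
qed

lemma commute_funpow:
  assumes "g \<circ> f = f \<circ> g"
  shows "g ((f ^^ n) x) = (f ^^ n) (g x)"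
proof (induction n)
  case (Suc n)
  have "g (f ((f ^^ n) x)) = f (g ((f ^^ n) x))" using fun_cong[OF assms, of "(f ^^ n) x"] by simp
  then show ?case using Suc by simp
qed simp

lemma local_form_comp_ex:
  assumes "local_form f x a b" "local_form g (f x) c d"
  shows "\<exists>a b. local_form (g \<circ> f) x a b"
  using local_form_comp[OF local_form_extend[OF assms(1), of c], of g "d + b"]
    local_form_extend[OF assms(2), of b] by (auto simp: add.commute)

lemma thompson_V_funpow_local_form:
  assumes "f \<in> carrier thompson_V"
  shows "\<exists>a b. local_form (f ^^ n) x a b"
proof (induction n)
  case 0
  have "local_form (f ^^ 0) x 0 0" by (simp add: local_form_def)
  then show ?case by blast
next
  case (Suc n)
  then obtain a b c d where "local_form (f ^^ n) x a b" "local_form f ((f ^^ n) x) c d"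
    using thompson_V_local_form[OF assms] by meson
  then show ?case using local_form_comp_ex by (metis funpow.simps(2))
qed

text \<open>The period in the two periodic cases of the trichotomy depends only on a cylinder of depth \<open>m\<close>, or
  on one of finitely many points, so one exponent serves all periodic points.\<close>

lemma nonperiodic_points_converge:
  assumes bij: "bij f" and m: "table_depth f m"
  obtains N where "N > 0"
    "\<And>y. (f ^^ N) y \<noteq> y \<Longrightarrow> \<exists>i n p. n > 0 \<and> p \<in> contracting_at f m \<and> (f ^^ n) p = p \<and>
            (\<forall>r. agree r p (((f ^^ n) ^^ r) ((f ^^ i) y)))"
proof -
  define T where "T = {t. length t = m \<and> (\<exists>n>0. \<forall>z. map z [0..<m] = t \<longrightarrow> (f ^^ n) z = z)}"
  have "finite T"
    by (rule finite_subset[OF _ finite_lists_length_eq[OF finite[of "UNIV :: bool set"], of m]])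
      (auto simp: T_def)
  moreover have "\<exists>n>0. \<forall>z. map z [0..<m] = t \<longrightarrow> (f ^^ n) z = z" if "t \<in> T" for t
    using that by (auto simp: T_def)
  moreover have "\<forall>z. map z [0..<m] = t \<longrightarrow> (f ^^ (n * k)) z = z"
    if "\<forall>z. map z [0..<m] = t \<longrightarrow> (f ^^ n) z = z" for t n k
    using that funpow_fixed_mult[of n f _ k] by blast
  ultimately have "\<exists>n>0. \<forall>t\<in>T. \<forall>z. map z [0..<m] = t \<longrightarrow> (f ^^ n) z = z"
    by (rule ex_common_multiple)
  then obtain N1 where N1: "N1 > 0"
      "\<And>t z. t \<in> T \<Longrightarrow> map z [0..<m] = t \<Longrightarrow> (f ^^ N1) z = z" by blast
  have "\<exists>n>0. (f ^^ n) p = p" if p: "p \<in> contracting_at (inv_into UNIV f) m" for p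
  proof -
    obtain n where "n > 0" "(inv_into UNIV f ^^ n) p = p"
      using p by (auto simp: contracting_at_def)
    moreover have "(f ^^ n) ((inv_into UNIV f ^^ n) p) = p"
      by (simp only: inv_fn[OF bij, symmetric] surj_f_inv_f[OF bij_is_surj[OF bij_fn[OF bij]]])
    ultimately show ?thesis by auto
  qed
  then have "\<exists>n>0. \<forall>p\<in>contracting_at (inv_into UNIV f) m. (f ^^ n) p = p"
    by (rule ex_common_multiple[where R = "\<lambda>p n. (f ^^ n) p = p", OF finite_contracting_at])
      (assumption, erule funpow_fixed_mult)
  then obtain N2 where N2: "N2 > 0"
      "\<And>p. p \<in> contracting_at (inv_into UNIV f) m \<Longrightarrow> (f ^^ N2) p = p" by blast
  show ?thesis
  proof (rule that)
    show "N1 * N2 > 0" using N1 N2 by simp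
    fix y assume y: "(f ^^ (N1 * N2)) y \<noteq> y"
    show "\<exists>i n p. n > 0 \<and> p \<in> contracting_at f m \<and> (f ^^ n) p = p \<and>
            (\<forall>r. agree r p (((f ^^ n) ^^ r) ((f ^^ i) y)))"
      using orbit_trichotomy[OF bij m, of y]
    proof (elim disjE)
      assume "\<exists>i n. n > 0 \<and> (\<forall>z. agree m ((f ^^ i) y) z \<longrightarrow> (f ^^ n) z = z)"
      then obtain i n where n: "n > 0" "\<forall>z. agree m ((f ^^ i) y) z \<longrightarrow> (f ^^ n) z = z" by blast
      then have "\<forall>z. map z [0..<m] = map ((f ^^ i) y) [0..<m] \<longrightarrow> (f ^^ n) z = z"
        by (simp only: agree_iff_map) metis
      then have "map ((f ^^ i) y) [0..<m] \<in> T" using n(1) by (auto simp: T_def)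
      then have "(f ^^ N1) ((f ^^ i) y) = (f ^^ i) y" using N1(2) by blast
      then have "(f ^^ N1) y = y" by (simp only: funpow_fixed_iterate[OF bij])
      then show ?thesis using y funpow_fixed_mult[of N1 f y N2] by blast
    next
      assume "\<exists>i. (f ^^ i) y \<in> contracting_at (inv_into UNIV f) m"
      then obtain i where "(f ^^ i) y \<in> contracting_at (inv_into UNIV f) m" by blast
      then have "(f ^^ N2) ((f ^^ i) y) = (f ^^ i) y" by (rule N2(2))
      then have "(f ^^ N2) y = y" by (simp only: funpow_fixed_iterate[OF bij])
      then show ?thesis using y funpow_fixed_mult[of N2 f y N1] by (simp add: mult.commute)
    qed assumption
  qed
qed

text \<open>In contrast to \<^const>\<open>contracting_at\<close> the depth is arbitrary here, so that the set does not depend on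
  coordinates and is preserved by everything that commutes with \<open>f\<close>.\<close>

definition contracting_points :: "(cantor \<Rightarrow> cantor) \<Rightarrow> cantor set" where
  "contracting_points f =
     {p. \<exists>n>0. \<exists>a b. a < b \<and> (f ^^ n) p = p \<and> local_form (f ^^ n) p a b}"

text \<open>Every contracting point \<open>q\<close> lies on the orbit of one of depth \<open>m\<close>: a point \<open>y \<noteq> q\<close> close to \<open>q\<close> is
  attracted by \<open>q\<close> and therefore not periodic, and so its orbit converges to a contracting point of depth
  \<open>m\<close>; the two limits must be in the same orbit.\<close>

lemma finite_contracting_points:
  assumes f: "f \<in> carrier thompson_V"
  shows "finite (contracting_points f)"
proof -
  note bij = thompson_V_bij[OF f]
  obtain m where m: "table_depth f m" using thompson_V_table_depth[OF f] .
  obtain N where N: "N > 0"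
    "\<And>y. (f ^^ N) y \<noteq> y \<Longrightarrow> \<exists>i n p. n > 0 \<and> p \<in> contracting_at f m \<and> (f ^^ n) p = p \<and>
            (\<forall>r. agree r p (((f ^^ n) ^^ r) ((f ^^ i) y)))"
    using nonperiodic_points_converge[OF bij m] by blast
  have "contracting_points f \<subseteq> (\<Union>p\<in>contracting_at f m. range (\<lambda>k. (f ^^ k) p))"
  proof
    fix q assume "q \<in> contracting_points f"
    then obtain n a b where q: "n > 0" "a < b" "(f ^^ n) q = q" "local_form (f ^^ n) q a b"
      by (auto simp: contracting_points_def)
    define y where "y = q(a := \<not> q a)"
    have "agree a q y" by (simp add: agree_def y_def)
    note y = contraction_iterate[OF q(3,4,2) this]
    have "(f ^^ N) y \<noteq> y"
    proof
      assume "(f ^^ N) y = y"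
      then have "(f ^^ (N * n)) y = y" by (rule funpow_fixed_mult)
      then have "((f ^^ n) ^^ N) y = y" by (simp only: funpow_mult mult.commute)
      then have "agree (a + N) q y" using y[of N] by simp
      then have "q a = y a" using N(1) unfolding agree_def by simp
      then show False by (simp add: y_def)
    qed
    then obtain i k p where p: "p \<in> contracting_at f m"
        "\<And>r. agree r p (((f ^^ k) ^^ r) ((f ^^ i) y))" "k > 0"
      using N(2) by blast
    have "\<exists>M\<ge>M0. agree M p ((f ^^ i) q)" for M0
    proof -
      obtain l where l: "\<And>z. agree l q z \<Longrightarrow> agree M0 ((f ^^ i) q) ((f ^^ i) z)"
        using local_form_agree thompson_V_funpow_local_form[OF f, of i q] by blast
      define R where "R = max l M0"
      \<comment> \<open>The exponent is a multiple of both periods, so this iterate is close to \<open>q\<close> while its image under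
        \<open>f ^^ i\<close> is close to \<open>p\<close>.\<close>
      define z where "z = (f ^^ (n * k * R)) y"
      have "R \<le> k * R" using p(3) by simp
      then have "l \<le> a + k * R" unfolding R_def by linarith
      then have "agree l q z"
        using agree_mono[OF y[of "k * R"]] by (simp only: z_def funpow_mult mult.assoc)
      then have "agree M0 ((f ^^ i) q) ((f ^^ i) z)" by (rule l)
      moreover have "(f ^^ i) z = ((f ^^ k) ^^ (n * R)) ((f ^^ i) y)"
        unfolding z_def funpow_mult by (subst funpow_comm_apply) (simp only: mult_ac)
      moreover have "M0 \<le> n * R"
      proof -
        have "R \<le> n * R" using q(1) by simp
        then show ?thesis unfolding R_def by linarith
      qed
      ultimately have "agree M0 ((f ^^ i) q) (((f ^^ k) ^^ (n * R)) ((f ^^ i) y))"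
        and "agree M0 p (((f ^^ k) ^^ (n * R)) ((f ^^ i) y))"
        using agree_mono[OF p(2)[of "n * R"]] by simp_all
      then have "agree M0 p ((f ^^ i) q)" using agree_trans agree_sym by blast
      then show ?thesis by blast
    qed
    then have pq: "p = (f ^^ i) q" by (rule agree_all_imp_eq)
    define l where "l = n * i - i"
    have "(f ^^ l) p = (f ^^ (l + i)) q" unfolding pq by (simp add: funpow_add)
    also have "l + i = n * i" using q(1) by (simp add: l_def)
    also have "(f ^^ (n * i)) q = q" using q(3) by (rule funpow_fixed_mult)
    finally have "q = (f ^^ l) p" by (rule sym)
    then show "q \<in> (\<Union>p\<in>contracting_at f m. range (\<lambda>k. (f ^^ k) p))" using p(1) by blast
  qed
  moreover have "finite (range (\<lambda>k. (f ^^ k) p))" if p: "p \<in> contracting_at f m" for p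
  proof -
    obtain n where n: "n > 0" "(f ^^ n) p = p" using p by (auto simp: contracting_at_def)
    have "range (\<lambda>k. (f ^^ k) p) \<subseteq> (\<lambda>k. (f ^^ k) p) ` {..<n}"
    proof (rule image_subsetI)
      fix k
      have "(f ^^ k) p = (f ^^ (k mod n)) p" by (rule funpow_mod_eq[OF n(2), symmetric])
      moreover have "k mod n \<in> {..<n}" using n(1) by simp
      ultimately show "(f ^^ k) p \<in> (\<lambda>k. (f ^^ k) p) ` {..<n}" by (rule image_eqI)
    qed
    then show ?thesis by (rule finite_subset) simp
  qed
  ultimately show ?thesis
    using finite_contracting_at finite_subset by blast
qed

lemma contracting_points_commute:
  assumes g: "g \<in> carrier thompson_V" and comm: "g \<circ> f = f \<circ> g"
    and p: "p \<in> contracting_points f"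
  shows "g p \<in> contracting_points f"
proof -
  obtain n a b where n: "n > 0" "a < b" "(f ^^ n) p = p" "local_form (f ^^ n) p a b"
    using p by (auto simp: contracting_points_def)
  obtain c d where cd: "local_form g p c d" using thompson_V_local_form[OF g] by blast
  note bij = thompson_V_bij[OF g]
  note gn = commute_funpow[OF comm]
  let ?i = "inv_into UNIV g"
  have inv_g: "?i (g p) = p" using bij_is_inj[OF bij] by simp
  have "local_form ?i (g p) (d + a) (c + a)"
    using local_form_extend[OF local_form_inv[OF bij cd]] .
  moreover have "local_form (f ^^ n) (?i (g p)) (c + a) (c + b)"
    using local_form_extend[OF n(4), of c] by (simp add: inv_g add.commute)
  ultimately have "local_form (f ^^ n \<circ> ?i) (g p) (d + a) (c + b)"
    by (rule local_form_comp)
  moreover have "local_form g ((f ^^ n \<circ> ?i) (g p)) (c + b) (d + b)"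
    using local_form_extend[OF cd, of b] by (simp add: inv_g n(3))
  ultimately have "local_form (g \<circ> (f ^^ n \<circ> ?i)) (g p) (d + a) (d + b)"
    by (rule local_form_comp)
  moreover have "g \<circ> (f ^^ n \<circ> ?i) = f ^^ n"
    by (rule ext) (simp only: comp_apply gn surj_f_inv_f[OF bij_is_surj[OF bij]])
  ultimately have "local_form (f ^^ n) (g p) (d + a) (d + b)" by simp
  moreover have "(f ^^ n) (g p) = g p" using gn[of n p] n(3) by simp
  moreover have "d + a < d + b" using n(2) by simp
  ultimately show ?thesis using n(1) unfolding contracting_points_def by blast
qed

text \<open>Every point moved by \<open>f ^^ N\<close> is eventually carried by \<open>f\<close> into the region near a contracting point
  where \<open>g\<close> is trivial, and \<open>g\<close> commutes with \<open>f\<close>.\<close>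

lemma commuting_trivial_on_support:
  assumes f: "f \<in> carrier thompson_V"
  obtains N where "N > 0"
    "\<And>g y. g \<circ> f = f \<circ> g \<Longrightarrow> 
       \<forall>p\<in>contracting_points f. \<exists>n. \<forall>z. agree n p z \<longrightarrow> g z = z \<Longrightarrow>
       (f ^^ N) y \<noteq> y \<Longrightarrow> g y = y"
proof -
  note bij = thompson_V_bij[OF f]
  obtain m where m: "table_depth f m" using thompson_V_table_depth[OF f] .
  obtain N where N: "N > 0"
    "\<And>y. (f ^^ N) y \<noteq> y \<Longrightarrow> \<exists>i n p. n > 0 \<and> p \<in> contracting_at f m \<and> (f ^^ n) p = p \<and>
            (\<forall>r. agree r p (((f ^^ n) ^^ r) ((f ^^ i) y)))"
    using nonperiodic_points_converge[OF bij m] by blast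
  show ?thesis
  proof (rule that[OF N(1)])
    fix g y
    assume comm: "g \<circ> f = f \<circ> g"
      and triv: "\<forall>p\<in>contracting_points f. \<exists>n. \<forall>z. agree n p z \<longrightarrow> g z = z"
      and y: "(f ^^ N) y \<noteq> y"
    obtain i n p where p: "p \<in> contracting_at f m"
        "\<And>r. agree r p (((f ^^ n) ^^ r) ((f ^^ i) y))"
      using N(2)[OF y] by blast
    have "p \<in> contracting_points f"
      using p(1) by (auto simp: contracting_at_def contracting_points_def)
    then obtain M where "\<And>z. agree M p z \<Longrightarrow> g z = z" using triv by blast
    then have "g (((f ^^ n) ^^ M) ((f ^^ i) y)) = ((f ^^ n) ^^ M) ((f ^^ i) y)"
      using p(2) by blast
    moreover have "((f ^^ n) ^^ M) ((f ^^ i) y) = (f ^^ (n * M + i)) y"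
      by (simp add: funpow_mult funpow_add)
    ultimately have "(f ^^ (n * M + i)) (g y) = (f ^^ (n * M + i)) y"
      by (simp only: commute_funpow[OF comm])
    then show "g y = y" using bij_is_inj[OF bij_fn[OF bij]] injD by metis
  qed
qed

section \<open>Commutators of homeomorphisms\<close>

text \<open>As products are read from left to right, this is the product of \<open>g\<close>, \<open>h\<close>,
  the inverse of \<open>g\<close> and the inverse of \<open>h\<close>, as in \<^const>\<open>derived\<close>.\<close>

definition commutator :: "('a \<Rightarrow> 'a) \<Rightarrow> ('a \<Rightarrow> 'a) \<Rightarrow> 'a \<Rightarrow> 'a" where
  "commutator g h = inv_into UNIV h \<circ> inv_into UNIV g \<circ> h \<circ> g"

lemma commutator_eqI:
  assumes "bij g" "bij h" "g \<circ> h \<circ> c = h \<circ> g"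
  shows "commutator g h = c"
proof
  fix x
  have "h (g x) = g (h (c x))" using assms(3) by (metis comp_apply)
  then show "commutator g h x = c x"
    using assms(1,2) by (simp add: commutator_def bij_is_inj)
qed

lemma comp_commutator:
  assumes "bij g" "bij h"
  shows "g (h (commutator g h x)) = h (g x)"
  using assms by (simp add: commutator_def bij_is_surj surj_f_inv_f)

lemma disjoint_supports_commute:
  assumes "inj f" "inj g" "\<And>x. f x = x \<or> g x = x"
  shows "f (g x) = g (f x)"
proof (cases "f x = x")
  case True
  then show ?thesis using assms by (metis injD)
next
  case False
  then show ?thesis using assms by (metis injD)
qed

interpretation homeo: group homeo_plus_real
  by (rule group_homeo_plus_real)

lemma homeo_mult [simp]: "f \<otimes>\<^bsub>homeo_plus_real\<^esub> g = g \<circ> f"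
  and homeo_one [simp]: "\<one>\<^bsub>homeo_plus_real\<^esub> = id"
  by (simp_all add: homeo_plus_real_def)

lemma homeo_inv:
  assumes "f \<in> carrier homeo_plus_real"
  shows "inv\<^bsub>homeo_plus_real\<^esub> f = inv_into UNIV f"
  using homeo.r_inv[OF assms] homeo.l_inv[OF assms] by (intro inv_unique_comp[symmetric]) auto

lemma homeo_bij: "f \<in> carrier homeo_plus_real \<Longrightarrow> bij f"
  using homeo.r_inv[of f] homeo.l_inv[of f] by (auto intro: o_bij)

lemma derived_subset:
  assumes "subgroup N homeo_plus_real" "S \<subseteq> carrier homeo_plus_real"
    and "\<And>g h. g \<in> S \<Longrightarrow> h \<in> S \<Longrightarrow> commutator g h \<in> N"
  shows "derived homeo_plus_real S \<subseteq> N"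
  unfolding derived_def
proof (rule homeo.generate_subgroup_incl[OF _ assms(1)])
  show "derived_set homeo_plus_real S \<subseteq> N"
  proof
    fix x assume "x \<in> derived_set homeo_plus_real S"
    then obtain g h where gh: "g \<in> S" "h \<in> S"
      "x = g \<otimes>\<^bsub>homeo_plus_real\<^esub> h \<otimes>\<^bsub>homeo_plus_real\<^esub> inv\<^bsub>homeo_plus_real\<^esub> g
         \<otimes>\<^bsub>homeo_plus_real\<^esub> inv\<^bsub>homeo_plus_real\<^esub> h" by auto
    moreover have "inv\<^bsub>homeo_plus_real\<^esub> g = inv_into UNIV g" "inv\<^bsub>homeo_plus_real\<^esub> h = inv_into UNIV h"
      using gh assms(2) homeo_inv by auto
    ultimately have "x = commutator g h" by (simp add: commutator_def comp_assoc)
    then show "x \<in> N" using assms(3) gh by simp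
  qed
qed

lemma commutator_in_derived:
  assumes "S \<subseteq> carrier homeo_plus_real" "g \<in> S" "h \<in> S"
  shows "commutator g h \<in> derived homeo_plus_real S"
proof -
  have "commutator g h = g \<otimes>\<^bsub>homeo_plus_real\<^esub> h \<otimes>\<^bsub>homeo_plus_real\<^esub> inv\<^bsub>homeo_plus_real\<^esub> g
         \<otimes>\<^bsub>homeo_plus_real\<^esub> inv\<^bsub>homeo_plus_real\<^esub> h"
    using homeo_inv[of g] homeo_inv[of h] assms by (simp add: commutator_def comp_assoc subset_iff)
  then show ?thesis unfolding derived_def using assms(2,3) by (intro generate.incl) auto
qed

section \<open>Locally moving groups of the line\<close>

locale locally_moving_group =
  fixes E :: "(real \<Rightarrow> real) set"
  assumes E_subgroup: "subgroup E homeo_plus_real"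
    and E_moving: "locally_moving E"
begin

lemma E_carrier: "f \<in> E \<Longrightarrow> f \<in> carrier homeo_plus_real"
  using E_subgroup subgroup.mem_carrier by metis

lemma E_comp: "f \<in> E \<Longrightarrow> g \<in> E \<Longrightarrow> f \<circ> g \<in> E"
  using subgroup.m_closed[OF E_subgroup, of g f] by simp

lemma E_id: "id \<in> E"
  using subgroup.one_closed[OF E_subgroup] by simp

lemma E_inv: "f \<in> E \<Longrightarrow> inv_into UNIV f \<in> E"
  using subgroup.m_inv_closed[OF E_subgroup, of f] homeo_inv[OF E_carrier] by simp

lemma E_bij: "f \<in> E \<Longrightarrow> bij f"
  by (rule homeo_bij[OF E_carrier])

lemma E_inj: "f \<in> E \<Longrightarrow> inj f"
  by (rule bij_is_inj[OF E_bij])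

lemma E_inv_f [simp]: "f \<in> E \<Longrightarrow> inv_into UNIV f (f x) = x"
  by (simp add: E_inj)

lemma E_f_inv [simp]: "f \<in> E \<Longrightarrow> f (inv_into UNIV f x) = x"
  by (simp add: E_bij bij_is_surj surj_f_inv_f)

lemma E_less [simp]: "f \<in> E \<Longrightarrow> f x < f y \<longleftrightarrow> x < y"
  using E_carrier[of f] by (simp add: homeo_plus_real_def strict_mono_less)

lemma E_le [simp]: "f \<in> E \<Longrightarrow> f x \<le> f y \<longleftrightarrow> x \<le> y"
  using E_less[of f y x] by (simp add: not_less[symmetric] del: E_less)

lemma E_inv_inv: "f \<in> E \<Longrightarrow> inv_into UNIV (inv_into UNIV f) = f"
  by (rule inv_inv_eq[OF E_bij])

lemma E_commutator: "f \<in> E \<Longrightarrow> g \<in> E \<Longrightarrow> commutator f g \<in> E"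
  by (simp add: commutator_def E_comp E_inv)

lemma supported_iff:
  "f \<in> supported_in E a b \<longleftrightarrow> f \<in> E \<and> (\<forall>x. x < a \<or> b < x \<longrightarrow> f x = x)"
  by (auto simp: supported_in_def Supp_def subset_eq) (meson not_le)+

lemma supported_E: "f \<in> supported_in E a b \<Longrightarrow> f \<in> E"
  by (simp add: supported_in_def)

lemma supported_carrier: "supported_in E a b \<subseteq> carrier homeo_plus_real"
  using E_carrier supported_E by blast

lemma supported_mono: "c \<le> a \<Longrightarrow> b \<le> d \<Longrightarrow> supported_in E a b \<subseteq> supported_in E c d"
  by (auto simp: supported_iff)

lemma supported_inv: "f \<in> supported_in E a b \<Longrightarrow> inv_into UNIV f \<in> supported_in E a b"
  unfolding supported_iff using E_inv E_inv_f by metis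

lemma supported_commutator:
  assumes "f \<in> supported_in E a b" "g \<in> supported_in E a b"
  shows "commutator f g \<in> supported_in E a b"
  using assms supported_inv[OF assms(1)] supported_inv[OF assms(2)] E_commutator[of f g]
  by (auto simp: supported_iff commutator_def)

lemma supported_subgroup: "subgroup (supported_in E a b) homeo_plus_real"
proof
  show "inv\<^bsub>homeo_plus_real\<^esub> f \<in> supported_in E a b" if "f \<in> supported_in E a b" for f
    using that supported_inv homeo_inv supported_carrier by (simp add: subset_iff)
qed (use supported_carrier E_comp E_id in \<open>auto simp: supported_iff\<close>)

lemma supported_preserves:
  assumes "f \<in> supported_in E a b" "a < p" "p < b"
  shows "a < f p" "f p < b"
proof -
  have f: "f \<in> E" "\<And>x. x < a \<or> b < x \<Longrightarrow> f x = x" using assms(1) by (auto simp: supported_iff)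
  have "f b \<le> b"
  proof (rule ccontr)
    assume "\<not> f b \<le> b"
    then have "f (f b) = f b" using f(2) by simp
    then show False using \<open>\<not> f b \<le> b\<close> E_inj[OF f(1)] by (metis injD order_refl)
  qed
  then show "f p < b" using E_less[OF f(1), of p b] assms(3) by linarith
  have "a \<le> f a"
  proof (rule ccontr)
    assume "\<not> a \<le> f a"
    then have "f (f a) = f a" using f(2) by simp
    then show False using \<open>\<not> a \<le> f a\<close> E_inj[OF f(1)] by (metis injD order_refl)
  qed
  then show "a < f p" using E_less[OF f(1), of a p] assms(2) by linarith
qed

lemma supported_conj:
  assumes "t \<in> E" "f \<in> supported_in E a b"
  shows "t \<circ> f \<circ> inv_into UNIV t \<in> supported_in E (t a) (t b)"
proof -
  have "f (inv_into UNIV t x) = inv_into UNIV t x" if "x < t a \<or> t b < x" for x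
  proof -
    have "inv_into UNIV t x < a \<or> b < inv_into UNIV t x"
      using that E_less[OF assms(1), of "inv_into UNIV t x" a] E_less[OF assms(1), of b "inv_into UNIV t x"]
        E_f_inv[OF assms(1)] by simp
    then show ?thesis using assms(2) by (auto simp: supported_iff)
  qed
  then show ?thesis using assms by (auto simp: supported_iff E_comp E_inv)
qed

text \<open>The group \<open>E[a,b]'\<close>, with the endpoints as arguments.\<close>

definition derived_on :: "real \<Rightarrow> real \<Rightarrow> (real \<Rightarrow> real) set" where
  "derived_on a b = derived homeo_plus_real (supported_in E a b)"

lemma derived_on_subgroup: "subgroup (derived_on a b) homeo_plus_real"
  unfolding derived_on_def by (rule homeo.derived_is_subgroup[OF supported_carrier])

lemma derived_on_carrier: "derived_on a b \<subseteq> carrier homeo_plus_real"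
  by (rule subgroup.subset[OF derived_on_subgroup])

lemma derived_on_commutator:
  "g \<in> supported_in E a b \<Longrightarrow> h \<in> supported_in E a b \<Longrightarrow> commutator g h \<in> derived_on a b"
  unfolding derived_on_def by (rule commutator_in_derived[OF supported_carrier])

lemma derived_on_supported: "derived_on a b \<subseteq> supported_in E a b"
  unfolding derived_on_def
  by (rule derived_subset[OF supported_subgroup supported_carrier supported_commutator])

lemma derived_on_E: "f \<in> derived_on a b \<Longrightarrow> f \<in> E"
  using derived_on_supported supported_E by blast

lemma derived_on_comp: "f \<in> derived_on a b \<Longrightarrow> g \<in> derived_on a b \<Longrightarrow> f \<circ> g \<in> derived_on a b"
  using subgroup.m_closed[OF derived_on_subgroup, of g _ _ f] by simp

lemma derived_on_inv: "f \<in> derived_on a b \<Longrightarrow> inv_into UNIV f \<in> derived_on a b"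
  using subgroup.m_inv_closed[OF derived_on_subgroup, of f] homeo_inv[OF E_carrier[OF derived_on_E]] by simp

lemma derived_on_id: "id \<in> derived_on a b"
  using subgroup.one_closed[OF derived_on_subgroup] by simp

lemma derived_on_mono: "c \<le> a \<Longrightarrow> b \<le> d \<Longrightarrow> derived_on a b \<subseteq> derived_on c d"
  unfolding derived_on_def by (rule homeo.mono_derived[OF supported_mono])

lemma derived_on_conj:
  assumes t: "t \<in> E" and f: "f \<in> derived_on a b"
  shows "t \<circ> f \<circ> inv_into UNIV t \<in> derived_on (t a) (t b)"
proof -
  define N where "N = {f \<in> E. t \<circ> f \<circ> inv_into UNIV t \<in> derived_on (t a) (t b)}"
  have inv_conj: "inv_into UNIV (t \<circ> g \<circ> inv_into UNIV t) = t \<circ> inv_into UNIV g \<circ> inv_into UNIV t"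
    if "g \<in> E" for g
    by (rule inv_unique_comp) (use that t in \<open>auto simp: fun_eq_iff\<close>)
  have "subgroup N homeo_plus_real"
  proof
    show "N \<subseteq> carrier homeo_plus_real" using E_carrier by (auto simp: N_def)
    fix g h assume g: "g \<in> N" and h: "h \<in> N"
    have "t \<circ> (h \<circ> g) \<circ> inv_into UNIV t = (t \<circ> h \<circ> inv_into UNIV t) \<circ> (t \<circ> g \<circ> inv_into UNIV t)"
      using t by (auto simp: fun_eq_iff)
    then show "g \<otimes>\<^bsub>homeo_plus_real\<^esub> h \<in> N"
      using g h E_comp derived_on_comp by (simp add: N_def)
  next
    show "\<one>\<^bsub>homeo_plus_real\<^esub> \<in> N"
    proof -
      have "t \<circ> id \<circ> inv_into UNIV t = id" using t by (auto simp: fun_eq_iff)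
      then show ?thesis using E_id derived_on_id by (simp add: N_def)
    qed
    fix g assume g: "g \<in> N"
    then have gE: "g \<in> E" by (simp add: N_def)
    have "inv_into UNIV g \<in> N"
      using g derived_on_inv[of "t \<circ> g \<circ> inv_into UNIV t"] E_inv[OF gE] by (simp add: N_def inv_conj)
    then show "inv\<^bsub>homeo_plus_real\<^esub> g \<in> N" using homeo_inv[OF E_carrier[OF gE]] by simp
  qed
  moreover have "commutator g h \<in> N" if g: "g \<in> supported_in E a b" and h: "h \<in> supported_in E a b" for g h
  proof -
    have gh: "g \<in> E" "h \<in> E" using g h supported_E by auto
    have "commutator (t \<circ> g \<circ> inv_into UNIV t) (t \<circ> h \<circ> inv_into UNIV t) \<in> derived_on (t a) (t b)"
      using derived_on_commutator supported_conj[OF t] g h by blast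
    also have "commutator (t \<circ> g \<circ> inv_into UNIV t) (t \<circ> h \<circ> inv_into UNIV t)
        = t \<circ> commutator g h \<circ> inv_into UNIV t"
      unfolding commutator_def inv_conj[OF gh(1)] inv_conj[OF gh(2)]
      using t by (auto simp: fun_eq_iff)
    finally show ?thesis using E_commutator[OF gh] unfolding N_def by blast
  qed
  ultimately have "derived_on a b \<subseteq> N" unfolding derived_on_def by (rule derived_subset[OF _ supported_carrier])
  then show ?thesis using f by (auto simp: N_def)
qed

lemma derived_on_conj_inside:
  assumes "t \<in> E" "f \<in> derived_on a b" "c \<le> t a" "t b \<le> d"
  shows "t \<circ> f \<circ> inv_into UNIV t \<in> derived_on c d"
  using derived_on_conj[OF assms(1,2)] derived_on_mono[OF assms(3,4)] by blast

text \<open>If \<open>h\<close> moves \<open>p\<close>, choose \<open>g\<close> moving \<open>p\<close> with support in an interval that contains \<open>p\<close> but not \<open>h p\<close>;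
  then the commutator of \<open>h\<close> and \<open>g\<close> moves \<open>p\<close>.\<close>

lemma derived_on_moves:
  assumes "a < p" "p < b"
  shows "\<exists>f\<in>derived_on a b. f p \<noteq> p"
proof -
  have ex: "\<exists>f\<in>supported_in E c d. f p \<noteq> p" if "c < p" "p < d" for c d
    using that E_moving unfolding locally_moving_def
    by (meson greaterThanLessThan_iff less_trans)
  obtain h where h: "h \<in> supported_in E a b" "h p \<noteq> p" using ex assms by blast
  obtain c d where cd: "a \<le> c" "c < p" "p < d" "d \<le> b" "h p < c \<or> d < h p"
  proof (cases "p < h p")
    case True
    then obtain d where "p < d" "d < min b (h p)" using dense[of p "min b (h p)"] assms by auto
    then show ?thesis using that[of a d] assms by auto
  next
    case False
    then obtain c where "max a (h p) < c" "c < p" using dense[of "max a (h p)" p] assms h by auto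
    then show ?thesis using that[of c b] assms by auto
  qed
  obtain g where g: "g \<in> supported_in E c d" "g p \<noteq> p" using ex cd by blast
  have gab: "g \<in> supported_in E a b" using supported_mono[OF cd(1,4)] g by blast
  have "g (h p) = h p" using g(1) cd(5) by (auto simp: supported_iff)
  then have "g (commutator h g p) = p"
    using supported_E[OF h(1)] supported_E[OF g(1)] by (simp add: commutator_def)
  then have "commutator h g p \<noteq> p" using g(2) by auto
  then show ?thesis using derived_on_commutator[OF h(1) gab] by blast
qed

text \<open>Otherwise the supremum of the orbit of \<open>p\<close> would be a fixed point in the interior.\<close>

lemma derived_on_up:
  assumes "a < p" "p < b" "q < b"
  shows "\<exists>f\<in>derived_on a b. q < f p"
proof (rule ccontr)
  assume "\<not> ?thesis"
  then have le: "f p \<le> q" if "f \<in> derived_on a b" for f using that by (meson not_le)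
  define s where "s = (SUP f\<in>derived_on a b. f p)"
  have bdd: "bdd_above ((\<lambda>f. f p) ` derived_on a b)" by (rule bdd_aboveI2) (rule le)
  have "p \<le> s" using cSUP_upper[OF derived_on_id bdd] by (simp add: s_def)
  moreover have "s \<le> q" unfolding s_def using derived_on_id le by (intro cSUP_least) auto
  ultimately obtain g where g: "g \<in> derived_on a b" "g s \<noteq> s" using derived_on_moves[of a s b] assms by auto
  obtain f where f: "f \<in> derived_on a b" "s < f s"
  proof (cases "s < g s")
    case False
    have "g (inv_into UNIV g s) = s" using derived_on_E[OF g(1)] by simp
    then have "s < inv_into UNIV g s"
      using False g(2) E_less[OF derived_on_E[OF g(1)], of s "inv_into UNIV g s"] by linarith
    then show ?thesis using that derived_on_inv[OF g(1)] by blast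
  qed (use g that in blast)
  have fE: "f \<in> E" using derived_on_E f by blast
  have "inv_into UNIV f s < s"
    using E_less[OF fE, of "inv_into UNIV f s" s] f(2) fE by simp
  then obtain h where h: "h \<in> derived_on a b" "inv_into UNIV f s < h p"
    unfolding s_def using less_cSUP_iff[OF _ bdd] derived_on_id by blast
  then have "s < f (h p)" using E_less[OF fE, of "inv_into UNIV f s" "h p"] fE by simp
  moreover have "f (h p) \<le> s"
    using cSUP_upper[OF derived_on_comp[OF f(1) h(1)] bdd] by (simp add: s_def)
  ultimately show False by simp
qed

lemma derived_on_down:
  assumes "a < p" "p < b" "a < q"
  shows "\<exists>f\<in>derived_on a b. f p < q"
proof (cases "q < b")
  case True
  obtain f where f: "f \<in> derived_on a b" "p < f q" using derived_on_up[of a q b p] assms True by blast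
  then have "inv_into UNIV f p < q"
    using E_less[OF derived_on_E[OF f(1)], of "inv_into UNIV f p" q] derived_on_E[OF f(1)] by simp
  then show ?thesis using derived_on_inv f by blast
next
  case False
  then show ?thesis using derived_on_id assms by (intro bexI[of _ id]) auto
qed

text \<open>First push \<open>r\<close> below \<open>d\<close>; then push the left end above \<open>c\<close> by an element supported to the left of
  \<open>d\<close>, which keeps the right end below \<open>d\<close>.\<close>

lemma derived_on_compress:
  assumes "a < c" "c < d" "d < b" "a < l" "l \<le> r" "r < b"
  shows "\<exists>t\<in>derived_on a b. c < t l \<and> t r < d"
proof -
  obtain f where f: "f \<in> derived_on a b" "f r < d" using derived_on_down[of a r b d] assms by force
  have fs: "f \<in> supported_in E a b" using f derived_on_supported by blast
  have lr: "a < f l" "f l \<le> f r"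
    using supported_preserves[OF fs] assms supported_E[OF fs] by auto
  obtain g where g: "g \<in> derived_on a d" "c < g (f l)" using derived_on_up[of a "f l" d c] lr f assms by force
  have "g \<in> supported_in E a d" using g derived_on_supported by blast
  then have "g (f r) < d" using supported_preserves[of g a d "f r"] lr f(2) by simp
  moreover have "g \<in> derived_on a b" using g derived_on_mono[of a a d b] assms by auto
  ultimately show ?thesis using derived_on_comp[OF _ f(1), of g] g by (intro bexI[of _ "g \<circ> f"]) auto
qed

text \<open>Multiply \<open>g\<close> and \<open>h\<close> by conjugates \<open>u\<close> and \<open>v\<close> of their inverses that are supported in two further
  disjoint intervals. The products are commutators, and the commutator of the products is that of \<open>g\<close>
  and \<open>h\<close>.\<close>

lemma derived_on_in_second_derived:
  assumes "l < a" "a < b" "b < r"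
  shows "derived_on a b \<subseteq> derived homeo_plus_real (derived_on l r)"
proof -
  have "commutator g h \<in> derived homeo_plus_real (derived_on l r)"
    if g: "g \<in> supported_in E a b" and h: "h \<in> supported_in E a b" for g h
  proof -
    have gE: "g \<in> E" and hE: "h \<in> E" using g h supported_E by auto
    have lr: "supported_in E a b \<subseteq> supported_in E l r" using supported_mono assms by simp
    obtain f where f: "f \<in> derived_on l r" "b < f a" using derived_on_up[of l a r b] assms by auto
    have fE: "f \<in> E" by (rule derived_on_E[OF f(1)])
    have "inv_into UNIV f \<in> supported_in E l r" using derived_on_inv[OF f(1)] derived_on_supported by blast
    then have "l < inv_into UNIV f a" "inv_into UNIV f a < r"
      using supported_preserves[of _ l r a] assms by auto
    then obtain k where k: "k \<in> derived_on l r" "b < k (inv_into UNIV f a)"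
      using derived_on_up[of l "inv_into UNIV f a" r b] assms by auto
    have kE: "k \<in> E" by (rule derived_on_E[OF k(1)])
    \<comment> \<open>The supports of \<open>g\<close> and \<open>h\<close>, of \<open>u\<close>, and of \<open>v\<close> lie in three disjoint intervals.\<close>
    define u where "u = inv_into UNIV f \<circ> inv_into UNIV g \<circ> f"
    define v where "v = inv_into UNIV k \<circ> inv_into UNIV h \<circ> k"
    have uE: "u \<in> E" and vE: "v \<in> E"
      using fE gE hE kE E_comp E_inv by (auto simp: u_def v_def)
    have u: "u x = x" if "f x < a \<or> b < f x" for x
      using that supported_inv[OF g] fE by (auto simp: u_def supported_iff)
    have v: "v x = x" if "k x < a \<or> b < k x" for x
      using that supported_inv[OF h] kE by (auto simp: v_def supported_iff)
    have fx: "b < f x" if "a \<le> x" for x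
      using E_le[OF fE, of a x] that f(2) by linarith
    have kx: "b < k x" if "a \<le> f x" for x
    proof -
      have "inv_into UNIV f a \<le> x" using E_le[OF fE, of "inv_into UNIV f a" x] that fE by simp
      then show ?thesis using E_le[OF kE, of "inv_into UNIV f a" x] k(2) by linarith
    qed
    have kx': "b < k x" if "a \<le> x" for x
      using kx[of x] fx[OF that] assms by linarith
    have hu: "h (u x) = u (h x)" for x
      using h fx by (intro disjoint_supports_commute E_inj hE uE) (metis u supported_iff not_le)
    have gv: "g (v x) = v (g x)" for x
      using g kx' by (intro disjoint_supports_commute E_inj gE vE) (metis v supported_iff not_le)
    have uv: "u (v x) = v (u x)" for x
      using kx by (intro disjoint_supports_commute E_inj uE vE) (metis u v not_le)
    have ug: "u \<circ> g = commutator g f" "v \<circ> h = commutator h k"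
      by (simp_all add: u_def v_def commutator_def)
    have "u \<circ> g \<in> derived_on l r" "v \<circ> h \<in> derived_on l r"
      unfolding ug using g h lr f k derived_on_supported by (auto intro!: derived_on_commutator)
    then have "commutator (u \<circ> g) (v \<circ> h) \<in> derived homeo_plus_real (derived_on l r)"
      by (rule commutator_in_derived[OF derived_on_carrier])
    also have "commutator (u \<circ> g) (v \<circ> h) = commutator g h"
    proof (rule commutator_eqI)
      show "bij (u \<circ> g)" "bij (v \<circ> h)" using uE gE vE hE E_comp E_bij by auto
      show "(u \<circ> g) \<circ> (v \<circ> h) \<circ> commutator g h = (v \<circ> h) \<circ> (u \<circ> g)"
        by (simp add: fun_eq_iff gv hu uv comp_commutator[OF E_bij[OF gE] E_bij[OF hE]])
    qed
    finally show ?thesis .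
  qed
  then show ?thesis
    unfolding derived_on_def[of a b]
    by (intro derived_subset supported_carrier homeo.derived_is_subgroup[OF derived_on_carrier])
qed

text \<open>Higman's argument. If \<open>m \<in> N\<close> carries a small interval \<open>(u1,u2)\<close> off itself, then for \<open>g\<close> and \<open>h\<close> supported there
  the commutator of \<open>g\<close> and \<open>h\<close> equals that of \<open>g \<circ> u\<close> and \<open>h\<close>, where \<open>u\<close> is a conjugate of the inverse of \<open>g\<close> by
  \<open>m\<close>, and \<open>g \<circ> u\<close> is in \<open>N\<close>. So \<open>N\<close> contains the group of a small interval, into which \<open>[c,d]\<close> can be
  compressed.\<close>

lemma normalized_subgroup_contains:
  assumes N: "subgroup N homeo_plus_real"
    and normal: "\<And>t n. t \<in> derived_on a b \<Longrightarrow> n \<in> N \<Longrightarrow> t \<circ> n \<circ> inv_into UNIV t \<in> N"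
    and n: "n \<in> N" "n \<in> E" "a < p" "p < b" "n p \<noteq> p"
    and cd: "a < c" "c < d" "d < b"
  shows "derived_on c d \<subseteq> N"
proof -
  have N_comp: "f \<circ> g \<in> N" if "f \<in> N" "g \<in> N" for f g
    using subgroup.m_closed[OF N that(2,1)] by simp
  have N_inv: "inv_into UNIV f \<in> N" if "f \<in> N" for f
    using subgroup.m_inv_closed[OF N that] homeo_inv subgroup.mem_carrier[OF N that] by simp
  obtain m where m: "m \<in> N" "m \<in> E" "p < m p"
  proof (cases "p < n p")
    case False
    then have "p < inv_into UNIV n p"
      using n E_less[OF n(2), of p "inv_into UNIV n p"] by simp
    then show ?thesis using that N_inv[OF n(1)] E_inv[OF n(2)] by blast
  qed (use n that in blast)
  obtain u2 where u2: "p < u2" "u2 < min b (m p)"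
    using dense[of p "min b (m p)"] m n by auto
  then have "inv_into UNIV m u2 < p"
    using E_less[OF m(2), of "inv_into UNIV m u2" p] m(2) by simp
  then obtain u1 where u1: "max a (inv_into UNIV m u2) < u1" "u1 < p"
    using dense[of "max a (inv_into UNIV m u2)" p] n by auto
  have mu: "u2 < m u1" using u1 E_less[OF m(2), of "inv_into UNIV m u2" u1] m(2) by simp
  have Dab: "derived_on u1 u2 \<subseteq> derived_on a b" using derived_on_mono u1 u2 by simp
  have comm: "commutator g h \<in> N" if g: "g \<in> derived_on u1 u2" and h: "h \<in> derived_on u1 u2" for g h
  proof -
    have gs: "g \<in> supported_in E u1 u2" and hs: "h \<in> supported_in E u1 u2"
      using g h derived_on_supported by auto
    have gE: "g \<in> E" and hE: "h \<in> E" using g h derived_on_E by auto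
    define u where "u = m \<circ> inv_into UNIV g \<circ> inv_into UNIV m"
    have uE: "u \<in> E" using m gE E_comp E_inv by (simp add: u_def)
    have "g \<circ> m \<circ> inv_into UNIV g \<in> N" using normal g Dab m by blast
    then have "(g \<circ> m \<circ> inv_into UNIV g) \<circ> inv_into UNIV m \<in> N" using N_comp N_inv m by blast
    then have kN: "g \<circ> u \<in> N" by (simp add: u_def comp_assoc)
    have kE: "g \<circ> u \<in> E" using gE uE E_comp by blast
    have ux: "u x = x" if "x \<le> u2" for x
    proof -
      have "inv_into UNIV m x < u1"
        using E_less[OF m(2), of "inv_into UNIV m x" u1] m(2) mu that by simp
      then have "inv_into UNIV g (inv_into UNIV m x) = inv_into UNIV m x"
        using supported_inv[OF gs] by (simp add: supported_iff)
      then show ?thesis using m(2) by (simp add: u_def)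
    qed
    have comm_u: "f (u x) = u (f x)" if "f \<in> supported_in E u1 u2" for f x
      using that by (intro disjoint_supports_commute E_inj uE supported_E[OF that])
        (metis ux supported_iff not_le)
    have c: "commutator g h \<in> supported_in E u1 u2" using gs hs by (rule supported_commutator)
    have "h \<circ> (g \<circ> u) \<circ> inv_into UNIV h \<in> N" using normal h Dab kN by blast
    then have "inv_into UNIV h \<circ> inv_into UNIV (g \<circ> u) \<circ> inv_into UNIV (inv_into UNIV h) \<in> N"
      using normal[of "inv_into UNIV h"] derived_on_inv[OF h] Dab N_inv[OF kN] by blast
    then have "inv_into UNIV h \<circ> inv_into UNIV (g \<circ> u) \<circ> h \<circ> (g \<circ> u) \<in> N"
      using N_comp kN E_inv_inv[OF hE] by simp
    also have "inv_into UNIV h \<circ> inv_into UNIV (g \<circ> u) \<circ> h \<circ> (g \<circ> u) = commutator g h"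
      unfolding commutator_def[of "g \<circ> u" h, symmetric]
    proof (rule commutator_eqI[OF E_bij[OF kE] E_bij[OF hE]])
      show "(g \<circ> u) \<circ> h \<circ> commutator g h = h \<circ> (g \<circ> u)"
        by (simp add: fun_eq_iff comm_u[OF hs, symmetric] comm_u[OF c, symmetric]
            comp_commutator[OF E_bij[OF gE] E_bij[OF hE]])
    qed
    finally show ?thesis .
  qed
  obtain v1 where v1: "u1 < v1" "v1 < p" using dense u1 by blast
  obtain v2 where v2: "p < v2" "v2 < u2" using dense u2 by blast
  have v12: "v1 < v2" using v1 v2 by simp
  have "derived_on v1 v2 \<subseteq> N"
    using derived_on_in_second_derived[OF v1(1) v12 v2(2)] derived_subset[OF N derived_on_carrier comm] by blast
  moreover obtain t where t: "t \<in> derived_on a b" "v1 < t c" "t d < v2"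
    using derived_on_compress[of a v1 v2 b c d] v12 u1 v1 u2 v2 cd by auto
  ultimately have conj: "t \<circ> f \<circ> inv_into UNIV t \<in> N" if "f \<in> derived_on c d" for f
    using derived_on_conj_inside[OF derived_on_E[OF t(1)] that, of v1 v2] by auto
  show ?thesis
  proof
    fix f assume f: "f \<in> derived_on c d"
    have "inv_into UNIV t \<circ> (t \<circ> f \<circ> inv_into UNIV t) \<circ> inv_into UNIV (inv_into UNIV t) \<in> N"
      using normal derived_on_inv[OF t(1)] conj[OF f] by blast
    also have "inv_into UNIV t \<circ> (t \<circ> f \<circ> inv_into UNIV t) \<circ> inv_into UNIV (inv_into UNIV t) = f"
      using derived_on_E[OF t(1)] by (simp add: fun_eq_iff E_inv_inv)
    finally show "f \<in> N" .
  qed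
qed

end

lemma bounded_by_interval:
  assumes "compact (C :: real set)"
  obtains r where "0 < r" "C \<subseteq> {-r<..<r}"
proof -
  obtain r where r: "\<And>x. x \<in> C \<Longrightarrow> \<bar>x\<bar> \<le> r"
    using compact_imp_bounded[OF assms] by (auto simp: bounded_iff)
  have "C \<subseteq> {- (max r 0 + 1)<..<max r 0 + 1}"
  proof
    fix x assume "x \<in> C"
    then have "\<bar>x\<bar> \<le> r" by (rule r)
    then show "x \<in> {- (max r 0 + 1)<..<max r 0 + 1}" unfolding greaterThanLessThan_iff by linarith
  qed
  then show ?thesis using that[of "max r 0 + 1"] by simp
qed

lemma open_contains_interval:
  assumes "open (V :: real set)" "p \<in> V"
  obtains a b where "a < p" "p < b" "{a..b} \<subseteq> V"
proof -
  obtain e where "e > 0" "cball p e \<subseteq> V" using assms open_contains_cball by blast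
  then show ?thesis using that[of "p - e" "p + e"] by (simp add: cball_eq_atLeastAtMost)
qed

section \<open>Groups of disjoint intervals cannot move the same point\<close>

locale thompson_action = locally_moving_group +
  fixes \<iota> :: "(real \<Rightarrow> real) \<Rightarrow> (cantor \<Rightarrow> cantor)"
  assumes \<iota>_mon: "\<iota> \<in> mon (homeo_plus_real\<lparr>carrier := E\<rparr>) thompson_V"
begin

lemma \<iota>_V: "f \<in> E \<Longrightarrow> \<iota> f \<in> carrier thompson_V"
  using \<iota>_mon by (auto simp: mon_def hom_def)

lemma \<iota>_bij: "f \<in> E \<Longrightarrow> bij (\<iota> f)"
  by (rule thompson_V_bij[OF \<iota>_V])

lemma \<iota>_injD: "f \<in> E \<Longrightarrow> \<iota> f x = \<iota> f y \<Longrightarrow> x = y"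
  using bij_is_inj[OF \<iota>_bij] by (metis injD)

lemma \<iota>_comp: "f \<in> E \<Longrightarrow> g \<in> E \<Longrightarrow> \<iota> (f \<circ> g) = \<iota> f \<circ> \<iota> g"
  using \<iota>_mon by (auto simp: mon_def hom_def thompson_V_def)

lemma \<iota>_id: "\<iota> id = id"
proof
  fix x
  have "\<iota> id (\<iota> id x) = \<iota> id x" using \<iota>_comp[OF E_id E_id] by (metis comp_apply comp_id)
  then show "\<iota> id x = id x" using \<iota>_injD[OF E_id] by simp
qed

lemma \<iota>_inv_f [simp]: "f \<in> E \<Longrightarrow> \<iota> (inv_into UNIV f) (\<iota> f x) = x"
  using \<iota>_comp[OF E_inv, of f f] E_inj[of f] by (simp add: \<iota>_id fun_eq_iff)

lemma \<iota>_f_inv [simp]: "f \<in> E \<Longrightarrow> \<iota> f (\<iota> (inv_into UNIV f) x) = x"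
  using \<iota>_inv_f[OF E_inv, of f x] by (simp add: E_inv_inv)

lemma \<iota>_inv: "f \<in> E \<Longrightarrow> \<iota> (inv_into UNIV f) = inv_into UNIV (\<iota> f)"
  by (intro inv_unique_comp[symmetric]) auto

lemma \<iota>_commutator:
  "g \<in> E \<Longrightarrow> h \<in> E \<Longrightarrow> \<iota> (commutator g h) = commutator (\<iota> g) (\<iota> h)"
  by (simp add: commutator_def \<iota>_comp \<iota>_inv E_comp E_inv)

lemma E_funpow: "f \<in> E \<Longrightarrow> f ^^ n \<in> E"
  using E_id E_comp by (induction n) auto

lemma derived_on_funpow: "f \<in> derived_on a b \<Longrightarrow> f ^^ n \<in> derived_on a b"
  using derived_on_id derived_on_comp by (induction n) auto

lemma \<iota>_funpow: "f \<in> E \<Longrightarrow> \<iota> (f ^^ n) = \<iota> f ^^ n"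
  by (induction n) (simp_all add: \<iota>_id \<iota>_comp E_funpow)

lemma funpow_moves:
  assumes f: "f \<in> E" "f q \<noteq> q" and n: "n > 0"
  shows "(f ^^ n) q \<noteq> q"
proof (cases "q < f q")
  case True
  have "q < (f ^^ Suc k) q" for k
  proof (induction k)
    case (Suc k)
    then have "f q < f ((f ^^ Suc k) q)" using E_less[OF f(1)] by blast
    then show ?case using True by simp
  qed (use True in simp)
  then show ?thesis using n by (metis Suc_pred less_irrefl)
next
  case False
  have "(f ^^ Suc k) q < q" for k
  proof (induction k)
    case (Suc k)
    then have "f ((f ^^ Suc k) q) < f q" using E_less[OF f(1)] by blast
    then show ?case using False by simp
  qed (use False f in simp)
  then show ?thesis using n by (metis Suc_pred less_irrefl)
qed

lemma fixator_subgroup: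
  assumes S: "subgroup S homeo_plus_real" "S \<subseteq> E"
  shows "subgroup {f \<in> S. \<forall>y\<in>Y. \<iota> f y = y} homeo_plus_real"
proof
  show "{f \<in> S. \<forall>y\<in>Y. \<iota> f y = y} \<subseteq> carrier homeo_plus_real"
    using subgroup.subset[OF S(1)] by blast
  show "f \<otimes>\<^bsub>homeo_plus_real\<^esub> g \<in> {f \<in> S. \<forall>y\<in>Y. \<iota> f y = y}"
    if "f \<in> {f \<in> S. \<forall>y\<in>Y. \<iota> f y = y}" "g \<in> {f \<in> S. \<forall>y\<in>Y. \<iota> f y = y}" for f g
    using that subgroup.m_closed[OF S(1), of f g] S(2) \<iota>_comp[of g f] by (auto simp: subset_iff)
  show "\<one>\<^bsub>homeo_plus_real\<^esub> \<in> {f \<in> S. \<forall>y\<in>Y. \<iota> f y = y}"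
    using subgroup.one_closed[OF S(1)] by (simp add: \<iota>_id)
  fix f assume f: "f \<in> {f \<in> S. \<forall>y\<in>Y. \<iota> f y = y}"
  then have fE: "f \<in> E" using S(2) by blast
  have "\<iota> (inv_into UNIV f) y = y" if "y \<in> Y" for y
    using f that \<iota>_inv_f[OF fE, of y] by simp
  then show "inv\<^bsub>homeo_plus_real\<^esub> f \<in> {f \<in> S. \<forall>y\<in>Y. \<iota> f y = y}"
    using f subgroup.m_inv_closed[OF S(1), of f] homeo_inv[OF E_carrier[OF fE]] by simp
qed

text \<open>Triviality of the germ refers to the action of \<open>f\<close> on the Cantor space, not on the line.\<close>

definition trivial_germ_at :: "cantor \<Rightarrow> (real \<Rightarrow> real) \<Rightarrow> bool" where
  "trivial_germ_at p f \<longleftrightarrow> (\<exists>n. \<forall>z. agree n p z \<longrightarrow> \<iota> f z = z)"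

lemma trivial_germ_subgroup: "subgroup {f \<in> E. trivial_germ_at p f} homeo_plus_real"
proof
  show "{f \<in> E. trivial_germ_at p f} \<subseteq> carrier homeo_plus_real" using E_carrier by blast
  show "\<one>\<^bsub>homeo_plus_real\<^esub> \<in> {f \<in> E. trivial_germ_at p f}"
    using E_id by (simp add: trivial_germ_at_def \<iota>_id)
next
  fix f g assume f: "f \<in> {f \<in> E. trivial_germ_at p f}" and g: "g \<in> {f \<in> E. trivial_germ_at p f}"
  obtain m where m: "\<And>z. agree m p z \<Longrightarrow> \<iota> f z = z" using f by (auto simp: trivial_germ_at_def)
  obtain n where n: "\<And>z. agree n p z \<Longrightarrow> \<iota> g z = z" using g by (auto simp: trivial_germ_at_def)
  have "\<iota> (g \<circ> f) z = z" if "agree (m + n) p z" for z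
    using m[of z] n[of z] that agree_mono[of "m + n" p z] f g by (simp add: \<iota>_comp)
  then have "trivial_germ_at p (g \<circ> f)" unfolding trivial_germ_at_def by blast
  then show "f \<otimes>\<^bsub>homeo_plus_real\<^esub> g \<in> {f \<in> E. trivial_germ_at p f}"
    using f g E_comp by simp
next
  fix f assume "f \<in> {f \<in> E. trivial_germ_at p f}"
  then have fE: "f \<in> E" and t: "trivial_germ_at p f" by auto
  obtain m where m: "\<And>z. agree m p z \<Longrightarrow> \<iota> f z = z" using t by (auto simp: trivial_germ_at_def)
  have "\<iota> (inv_into UNIV f) z = z" if "agree m p z" for z
    using m[OF that] \<iota>_inv_f[OF fE, of z] by simp
  then have "trivial_germ_at p (inv_into UNIV f)" unfolding trivial_germ_at_def by blast
  then show "inv\<^bsub>homeo_plus_real\<^esub> f \<in> {f \<in> E. trivial_germ_at p f}"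
    using E_inv[OF fE] homeo_inv[OF E_carrier[OF fE]] by simp
qed

lemma commutator_trivial_germ:
  assumes "g \<in> E" "h \<in> E" "\<iota> g p = p" "\<iota> h p = p"
  shows "trivial_germ_at p (commutator g h)"
proof -
  obtain a b where g: "local_form (\<iota> g) p a b" using thompson_V_local_form \<iota>_V assms by blast
  obtain c d where h: "local_form (\<iota> h) p c d" using thompson_V_local_form \<iota>_V assms by blast
  have "\<iota> (commutator g h) z = z" if "agree (a + c) p z" for z
  proof -
    have eq: "\<iota> g (\<iota> h z) = \<iota> h (\<iota> g z)"
      using local_form_commute[OF g assms(3) h assms(4) that] .
    have "\<iota> (commutator g h) z = inv_into UNIV (\<iota> h) (inv_into UNIV (\<iota> g) (\<iota> g (\<iota> h z)))"
      by (simp add: \<iota>_commutator[OF assms(1,2)] commutator_def[of "\<iota> g" "\<iota> h"] eq)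
    also have "\<dots> = z"
      using bij_is_inj[OF \<iota>_bij[OF assms(1)]] bij_is_inj[OF \<iota>_bij[OF assms(2)]] by simp
    finally show ?thesis .
  qed
  then show ?thesis unfolding trivial_germ_at_def by blast
qed

lemma derived_trivial_germ:
  assumes "S \<subseteq> E" "\<And>f. f \<in> S \<Longrightarrow> \<iota> f p = p" "f \<in> derived homeo_plus_real S"
  shows "trivial_germ_at p f"
proof -
  have "derived homeo_plus_real S \<subseteq> {f \<in> E. trivial_germ_at p f}"
  proof (rule derived_subset[OF trivial_germ_subgroup])
    show "S \<subseteq> carrier homeo_plus_real" using assms(1) E_carrier by blast
    show "commutator g h \<in> {f \<in> E. trivial_germ_at p f}" if "g \<in> S" "h \<in> S" for g h
      using that assms(1,2) commutator_trivial_germ[of g h p] E_commutator[of g h] by auto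
  qed
  then show ?thesis using assms(3) by blast
qed

definition moves :: "cantor \<Rightarrow> real \<Rightarrow> real \<Rightarrow> bool" where
  "moves x a b \<longleftrightarrow> (\<exists>f\<in>derived_on a b. \<iota> f x \<noteq> x)"

lemma moves_conj:
  assumes "t \<in> E" "moves x a b"
  shows "moves (\<iota> t x) (t a) (t b)"
proof -
  obtain f where f: "f \<in> derived_on a b" "\<iota> f x \<noteq> x" using assms(2) by (auto simp: moves_def)
  have fE: "f \<in> E" by (rule derived_on_E[OF f(1)])
  have "\<iota> (t \<circ> f \<circ> inv_into UNIV t) (\<iota> t x) = \<iota> t (\<iota> f x)"
    using assms(1) fE by (simp add: \<iota>_comp E_comp E_inv)
  then have "\<iota> (t \<circ> f \<circ> inv_into UNIV t) (\<iota> t x) \<noteq> \<iota> t x"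
    using f(2) \<iota>_injD[OF assms(1)] by metis
  then show ?thesis using derived_on_conj[OF assms(1) f(1)] by (auto simp: moves_def)
qed

lemma derived_on_disjoint_commute:
  assumes "f \<in> derived_on a b" "g \<in> derived_on c d" "b < c"
  shows "\<iota> f \<circ> \<iota> g = \<iota> g \<circ> \<iota> f"
proof -
  have f: "f \<in> supported_in E a b" and g: "g \<in> supported_in E c d"
    using assms derived_on_supported by auto
  have "f x = x \<or> g x = x" for x
  proof (cases "b < x")
    case True
    then show ?thesis using f by (simp add: supported_iff)
  next
    case False
    then show ?thesis using g assms(3) by (simp add: supported_iff)
  qed
  then have "f (g x) = g (f x)" for x
    by (rule disjoint_supports_commute[OF E_inj[OF derived_on_E[OF assms(1)]] E_inj[OF derived_on_E[OF assms(2)]]])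
  then have "f \<circ> g = g \<circ> f" by (simp add: fun_eq_iff)
  then show ?thesis using \<iota>_comp derived_on_E assms(1,2) by metis
qed

lemma permuting_power_fixes:
  assumes "finite P" "\<And>p. p \<in> P \<Longrightarrow> g p \<in> P" "inj g"
  obtains n where "n > 0" "\<And>p. p \<in> P \<Longrightarrow> (g ^^ n) p = p"
proof -
  have "\<exists>n>0. (g ^^ n) p = p" if p: "p \<in> P" for p
  proof -
    have "(g ^^ n) p \<in> P" for n using assms(2) p by (induction n) auto
    then have "finite {y. \<exists>n. y = (g ^^ n) p}"
      by (intro finite_subset[OF _ assms(1)]) auto
    then show ?thesis using funpow_inj_finite[OF assms(3)] by metis
  qed
  then have "\<exists>n>0. \<forall>p\<in>P. (g ^^ n) p = p"
    by (rule ex_common_multiple[where R = "\<lambda>p n. (g ^^ n) p = p", OF assms(1)])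
      (assumption, erule funpow_fixed_mult)
  then show ?thesis using that by blast
qed

text \<open>The elements of a group slightly larger than \<open>E[a,b]'\<close> that fix all contracting points of \<open>\<iota> f\<close> form a normal
  subgroup, which is nontrivial because it contains a power of each element. It therefore
  contains an intermediate group, and \<open>E[a,b]'\<close> consists of products of commutators in that.\<close>

lemma commuting_interval_trivial_on_support:
  assumes f: "f \<in> derived_on c d" and ab: "a < b" "b < c"
  obtains N where "N > 0"
    "\<And>g y. g \<in> derived_on a b \<Longrightarrow> (\<iota> f ^^ N) y \<noteq> y \<Longrightarrow> \<iota> g y = y"
proof -
  have fV: "\<iota> f \<in> carrier thompson_V" by (rule \<iota>_V[OF derived_on_E[OF f]])
  define P where "P = contracting_points (\<iota> f)"
  have finP: "finite P" unfolding P_def by (rule finite_contracting_points[OF fV])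
  obtain b2 where b2: "b < b2" "b2 < c" using dense ab by blast
  obtain b1 where b1: "b < b1" "b1 < b2" using dense b2 by blast
  have permP: "\<iota> t p \<in> P" if "t \<in> derived_on (a - 2) b2" "p \<in> P" for t p
    using that contracting_points_commute[OF \<iota>_V[OF derived_on_E] derived_on_disjoint_commute[OF _ f b2(2)]]
    unfolding P_def by blast
  define K where "K = {g \<in> derived_on (a - 2) b2. \<forall>p\<in>P. \<iota> g p = p}"
  have K: "subgroup K homeo_plus_real"
    unfolding K_def by (rule fixator_subgroup[OF derived_on_subgroup]) (use derived_on_E in blast)
  have normal: "t \<circ> n \<circ> inv_into UNIV t \<in> K" if t: "t \<in> derived_on (a - 2) b2" and n: "n \<in> K" for t n
  proof -
    have nD: "n \<in> derived_on (a - 2) b2" using n by (simp add: K_def)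
    have tE: "t \<in> E" and nE: "n \<in> E" using t nD derived_on_E by auto
    have "\<iota> (t \<circ> n \<circ> inv_into UNIV t) p = p" if "p \<in> P" for p
    proof -
      have "\<iota> (inv_into UNIV t) p \<in> P" using permP derived_on_inv t that by blast
      then have "\<iota> n (\<iota> (inv_into UNIV t) p) = \<iota> (inv_into UNIV t) p" using n by (simp add: K_def)
      then show ?thesis using tE nE by (simp add: \<iota>_comp E_comp E_inv)
    qed
    moreover have "t \<circ> n \<circ> inv_into UNIV t \<in> derived_on (a - 2) b2" using derived_on_comp derived_on_inv t nD by blast
    ultimately show ?thesis by (simp add: K_def)
  qed
  obtain g where g: "g \<in> derived_on (a - 2) b2" "g a \<noteq> a" using derived_on_moves[of "a - 2" a b2] ab b2 by auto
  have gE: "g \<in> E" by (rule derived_on_E[OF g(1)])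
  obtain n where n: "n > 0" "\<And>p. p \<in> P \<Longrightarrow> (\<iota> g ^^ n) p = p"
    using permuting_power_fixes[OF finP permP[OF g(1)] bij_is_inj[OF \<iota>_bij[OF gE]]] by blast
  have gn: "g ^^ n \<in> K" using derived_on_funpow[OF g(1)] n(2) \<iota>_funpow[OF gE] by (simp add: K_def)
  have "derived_on (a - 1) b1 \<subseteq> K"
  proof (rule normalized_subgroup_contains[OF K _ gn E_funpow[OF gE] _ _ funpow_moves[OF gE g(2) n(1)]])
    show "t \<circ> n \<circ> inv_into UNIV t \<in> K" if "t \<in> derived_on (a - 2) b2" "n \<in> K" for t n
      using that by (rule normal)
  qed (use ab b1 b2 in simp_all)
  then have fixP: "\<iota> g p = p" if "g \<in> derived_on (a - 1) b1" "p \<in> P" for g p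
    using that by (auto simp: K_def)
  have germs: "trivial_germ_at p g" if "g \<in> derived_on a b" "p \<in> P" for g p
  proof (rule derived_trivial_germ)
    show "derived_on (a - 1) b1 \<subseteq> E" using derived_on_E by blast
    show "g \<in> derived homeo_plus_real (derived_on (a - 1) b1)"
      using derived_on_in_second_derived[of "a - 1" a b b1] ab b1 that by auto
  qed (use fixP that in blast)
  obtain N where N: "N > 0"
    "\<And>g y. g \<circ> \<iota> f = \<iota> f \<circ> g \<Longrightarrow> 
       \<forall>p\<in>contracting_points (\<iota> f). \<exists>n. \<forall>z. agree n p z \<longrightarrow> g z = z \<Longrightarrow>
       (\<iota> f ^^ N) y \<noteq> y \<Longrightarrow> g y = y"
    using commuting_trivial_on_support[OF fV] by blast
  show ?thesis
  proof (rule that[OF N(1)])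
    fix g y assume "g \<in> derived_on a b" "(\<iota> f ^^ N) y \<noteq> y"
    then show "\<iota> g y = y"
      using N(2)[OF derived_on_disjoint_commute[OF _ f ab(2)]] germs
      unfolding P_def trivial_germ_at_def by blast
  qed
qed

text \<open>Let \<open>B\<close> be the group of an interval slightly larger than \<open>[c,d]\<close>. Every point of the \<open>B\<close>-orbit \<open>Y\<close> of \<open>x\<close> is
  moved by \<open>g\<close>, which commutes with \<open>B\<close>, so a power of \<open>f\<close> fixes \<open>Y\<close> pointwise. The pointwise
  stabiliser of \<open>Y\<close> is thus a nontrivial normal subgroup of \<open>B\<close>.\<close>

lemma not_moves_disjoint:
  assumes "a < b" "b < c" "c < d" "moves x a b"
  shows "\<not> moves x c d"
proof -
  obtain g where g: "g \<in> derived_on a b" "\<iota> g x \<noteq> x" using assms(4) by (auto simp: moves_def)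
  obtain e where e: "b < e" "e < c" using dense assms by blast
  define B where "B = derived_on e (d + 1)"
  define Y where "Y = (\<lambda>h. \<iota> h x) ` B"
  define M where "M = {f \<in> B. \<forall>y\<in>Y. \<iota> f y = y}"
  have M: "subgroup M homeo_plus_real"
    unfolding M_def B_def by (rule fixator_subgroup[OF derived_on_subgroup]) (use derived_on_E in blast)
  have BE: "f \<in> E" if "f \<in> B" for f using that derived_on_E by (simp add: B_def)
  have BY: "\<iota> t y \<in> Y" if t: "t \<in> B" and y: "y \<in> Y" for t y
  proof -
    obtain h where h: "h \<in> B" "y = \<iota> h x" using y by (auto simp: Y_def)
    then have "\<iota> t y = \<iota> (t \<circ> h) x" using \<iota>_comp BE t by simp
    moreover have "t \<circ> h \<in> B" using h t derived_on_comp by (simp add: B_def)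
    ultimately show ?thesis by (auto simp: Y_def)
  qed
  have normal: "t \<circ> n \<circ> inv_into UNIV t \<in> M" if t: "t \<in> B" and n: "n \<in> M" for t n
  proof -
    have nB: "n \<in> B" using n by (simp add: M_def)
    have tE: "t \<in> E" and nE: "n \<in> E" using t nB BE by auto
    have tB: "inv_into UNIV t \<in> B" using t derived_on_inv by (simp add: B_def)
    have "\<iota> (t \<circ> n \<circ> inv_into UNIV t) y = y" if "y \<in> Y" for y
    proof -
      have "\<iota> n (\<iota> (inv_into UNIV t) y) = \<iota> (inv_into UNIV t) y"
        using n BY[OF tB that] by (simp add: M_def)
      then show ?thesis using tE nE by (simp add: \<iota>_comp E_comp E_inv)
    qed
    moreover have "t \<circ> n \<circ> inv_into UNIV t \<in> B" using derived_on_comp t nB tB by (simp add: B_def)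
    ultimately show ?thesis by (simp add: M_def)
  qed
  obtain f where f: "f \<in> B" "f c \<noteq> c" using derived_on_moves[of e c "d + 1"] e assms by (auto simp: B_def)
  have fE: "f \<in> E" by (rule BE[OF f(1)])
  obtain N where N: "N > 0" "\<And>g y. g \<in> derived_on a b \<Longrightarrow> (\<iota> f ^^ N) y \<noteq> y \<Longrightarrow> \<iota> g y = y"
    using commuting_interval_trivial_on_support[of f e "d + 1" a b] f e assms by (auto simp: B_def)
  have "\<iota> (f ^^ N) y = y" if "y \<in> Y" for y
  proof (rule ccontr)
    assume "\<iota> (f ^^ N) y \<noteq> y"
    then have fy: "\<iota> g y = y" using N(2)[OF g(1)] \<iota>_funpow[OF fE] by simp
    obtain h where h: "h \<in> B" "y = \<iota> h x" using \<open>y \<in> Y\<close> by (auto simp: Y_def)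
    have "\<iota> g \<circ> \<iota> h = \<iota> h \<circ> \<iota> g"
      using derived_on_disjoint_commute[OF g(1) _ e(1)] h(1) by (simp add: B_def)
    then have "\<iota> h (\<iota> g x) = \<iota> h x" using fy h(2) by (metis comp_apply)
    then show False using g(2) \<iota>_injD BE[OF h(1)] by blast
  qed
  then have fN: "f ^^ N \<in> M" using f(1) derived_on_funpow by (simp add: M_def B_def)
  have "derived_on c d \<subseteq> M"
  proof (rule normalized_subgroup_contains[OF M _ fN E_funpow[OF fE] _ _ funpow_moves[OF fE f(2) N(1)]])
    show "t \<circ> n \<circ> inv_into UNIV t \<in> M" if "t \<in> derived_on e (d + 1)" "n \<in> M" for t n
      using normal that by (simp add: B_def)
  qed (use e assms in simp_all)
  moreover have "x \<in> Y" unfolding Y_def B_def using derived_on_id \<iota>_id by (metis id_apply imageI)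
  ultimately show ?thesis by (auto simp: moves_def M_def)
qed

section \<open>The map to the circle\<close>

text \<open>The first conjunct excludes the points that go to infinity, for which the second is vacuous.\<close>

definition located :: "cantor \<Rightarrow> real \<Rightarrow> bool" where
  "located x p \<longleftrightarrow> (\<exists>a b. a < b \<and> moves x a b) \<and> (\<forall>a b. a < b \<and> moves x a b \<longrightarrow> a \<le> p \<and> p \<le> b)"

text \<open>The left ends of the intervals whose groups move \<open>x\<close> lie below the right ends, as no two of these
  intervals are disjoint.\<close>

lemma located_exists:
  assumes "a < b" "moves x a b"
  shows "\<exists>p. located x p"
proof -
  define L where "L = {a. \<exists>b. a < b \<and> moves x a b}"
  have le: "a' \<le> b'" if "a' \<in> L" "c < b'" "moves x c b'" for a' b' c
    using that not_moves_disjoint[of c b' a'] by (force simp: L_def not_le[symmetric])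
  have "bdd_above L" using le assms by (intro bdd_aboveI[of _ b]) blast
  then have "c \<le> Sup L \<and> Sup L \<le> d" if "c < d" "moves x c d" for c d
    using that le assms by (auto intro!: cSup_upper cSup_least simp: L_def)
  then show ?thesis using assms unfolding located_def by blast
qed

text \<open>Suppose that \<open>E[a,b]'\<close> fixes \<open>x\<close>. So does the group of every interval to the right of \<open>p\<close>,
  because \<open>p\<close> lies in all intervals whose group moves \<open>x\<close>. An element of
  the former moves \<open>p\<close> to the right, and one of the latter moves it on beyond any interval \<open>[c,d]\<close> whose
  group moves \<open>x\<close>. Their product \<open>h\<close> fixes \<open>x\<close>, so the group of the preimage of \<open>[c,d]\<close> under \<open>h\<close> also moves
  \<open>x\<close>, but this interval does not contain \<open>p\<close>.\<close>

lemma located_moves: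
  assumes p: "located x p" and ab: "a < p" "p < b"
  shows "moves x a b"
proof (rule ccontr)
  assume not: "\<not> moves x a b"
  obtain c d where cd: "c < d" "moves x c d" using p by (auto simp: located_def)
  obtain f where f: "f \<in> derived_on a b" "p < f p" using derived_on_up[of a p b p] ab by auto
  obtain m where m: "p < m" "m < f p" using dense f by blast
  define r where "r = max (f p) d + 1"
  have r: "f p < r" "d < r" by (simp_all add: r_def)
  have "\<not> moves x m r"
    using p m r unfolding located_def by (meson less_trans not_le)
  moreover obtain g where g: "g \<in> derived_on m r" "d < g (f p)"
    using derived_on_up[OF m(2) r] by blast
  ultimately have fixed: "\<iota> f x = x" "\<iota> g x = x" using f not by (auto simp: moves_def)
  define h where "h = g \<circ> f"
  have gf: "g \<in> E" "f \<in> E" using derived_on_E f g by auto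
  then have h: "h \<in> E" "\<iota> h x = x" using fixed by (auto simp: h_def E_comp \<iota>_comp)
  have hx: "\<iota> (inv_into UNIV h) x = x" using \<iota>_inv_f[OF h(1), of x] h(2) by simp
  have "moves x (inv_into UNIV h c) (inv_into UNIV h d)"
    using moves_conj[OF E_inv[OF h(1)] cd(2)] hx by simp
  moreover have "inv_into UNIV h c < inv_into UNIV h d" using E_inv[OF h(1)] cd(1) by simp
  ultimately have "p \<le> inv_into UNIV h d" using p by (auto simp: located_def)
  then have "h p \<le> d" using E_le[OF h(1), of p "inv_into UNIV h d"] h(1) by simp
  then show False using g(2) by (simp add: h_def)
qed

lemma located_unique:
  assumes "located x p" "located x q"
  shows "p = q"
proof -
  have "q \<le> p" if pq: "located x p" "located x q" for p q
  proof (rule ccontr)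
    assume "\<not> q \<le> p"
    then obtain m where m: "p < m" "m < q" using dense[of p q] by auto
    then have "moves x (p - 1) m" using located_moves[OF pq(1), of "p - 1" m] by simp
    moreover have "p - 1 < m" using m by simp
    ultimately have "q \<le> m" using pq(2) unfolding located_def by blast
    then show False using m by simp
  qed
  then show ?thesis using assms by (meson antisym)
qed

lemma located_equivariant:
  assumes "f \<in> E" "located x p"
  shows "located (\<iota> f x) (f p)"
  unfolding located_def
proof (intro conjI allI impI)
  obtain a b where "a < b" "moves x a b" using assms(2) by (auto simp: located_def)
  then show "\<exists>a b. a < b \<and> moves (\<iota> f x) a b"
    using moves_conj[OF assms(1)] E_less[OF assms(1)] by blast
next
  fix a b assume ab: "a < b \<and> moves (\<iota> f x) a b"
  note iE = E_inv[OF assms(1)]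
  have "moves x (inv_into UNIV f a) (inv_into UNIV f b)"
    using moves_conj[OF iE] ab assms(1) by fastforce
  then have le: "inv_into UNIV f a \<le> p" "p \<le> inv_into UNIV f b"
    using assms(2) ab E_less[OF iE, of a b] by (auto simp: located_def)
  show "a \<le> f p" using le(1) E_le[OF assms(1), of "inv_into UNIV f a" p] assms(1) by simp
  show "f p \<le> b" using le(2) E_le[OF assms(1), of p "inv_into UNIV f b"] assms(1) by simp
qed

text \<open>Being moved by a given element is an open condition.\<close>

lemma located_nearby:
  assumes "located x p" "a < p" "p < b"
  shows "\<exists>n. \<forall>y. agree n x y \<longrightarrow> (\<exists>q. located y q \<and> a \<le> q \<and> q \<le> b)"
proof -
  obtain f where f: "f \<in> derived_on a b" "\<iota> f x \<noteq> x" using located_moves[OF assms] by (auto simp: moves_def)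
  then obtain i where i: "\<iota> f x i \<noteq> x i" by (auto simp: fun_eq_iff)
  obtain c d where "local_form (\<iota> f) x c d" using thompson_V_local_form \<iota>_V derived_on_E f by blast
  then obtain k where k: "\<And>y. agree k x y \<Longrightarrow> agree (Suc i) (\<iota> f x) (\<iota> f y)"
    using local_form_agree by blast
  have "\<exists>q. located y q \<and> a \<le> q \<and> q \<le> b" if y: "agree (k + Suc i) x y" for y
  proof -
    have "agree k x y" "agree (Suc i) x y" using agree_mono[OF y] by simp_all
    then have "\<iota> f y i \<noteq> y i" using k[of y] i by (simp add: agree_def)
    then have "\<iota> f y \<noteq> y" by metis
    then have my: "moves y a b" using f(1) by (auto simp: moves_def)
    have "a < b" using assms by simp
    moreover obtain q where "located y q" using located_exists[OF \<open>a < b\<close> my] by blast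
    ultimately show ?thesis using my unfolding located_def by blast
  qed
  then show ?thesis by blast
qed

text \<open>The generators of the intermediate group are products of commutators of elements fixing \<open>x\<close>, so they
  have trivial germs at \<open>x\<close>; being finitely many, they fix a common neighbourhood of \<open>x\<close>.\<close>

lemma unmoved_nearby:
  assumes FG: "FG_filtered E" and x: "\<And>a b. a < b \<Longrightarrow> \<not> moves x a b" and ab: "a < b"
  shows "\<exists>n. \<forall>y. agree n x y \<longrightarrow> \<not> moves y a b"
proof -
  obtain l r K where lr: "l < a" "b < r"
    and K: "finitely_generated_subgroup homeo_plus_real K" "K \<subseteq> derived_on l r" "derived_on a b \<subseteq> K"
    using FG ab unfolding FG_filtered_def derived_on_def by blast
  obtain S where S: "finite S" "S \<subseteq> carrier homeo_plus_real" "generate homeo_plus_real S = K"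
    using K(1) by (auto simp: finitely_generated_subgroup_def)
  have "S \<subseteq> K" unfolding S(3)[symmetric] by (rule subsetI) (rule generate.incl)
  then have SD: "S \<subseteq> derived_on l r" using K(2) by blast
  have germ: "trivial_germ_at x s" if "s \<in> S" for s
  proof (rule derived_trivial_germ)
    show "derived_on (l - 1) (r + 1) \<subseteq> E" using derived_on_E by blast
    show "s \<in> derived homeo_plus_real (derived_on (l - 1) (r + 1))"
      using derived_on_in_second_derived[of "l - 1" l r "r + 1"] lr ab SD that by auto
    show "\<iota> f x = x" if "f \<in> derived_on (l - 1) (r + 1)" for f
      using x[of "l - 1" "r + 1"] lr ab that by (auto simp: moves_def)
  qed
  then obtain n where n: "\<And>s z. s \<in> S \<Longrightarrow> agree (n s) x z \<Longrightarrow> \<iota> s z = z"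
    unfolding trivial_germ_at_def by metis
  define m where "m = Max (insert 0 (n ` S))"
  have m: "n s \<le> m" if "s \<in> S" for s using that S(1) by (simp add: m_def)
  have "\<not> moves y a b" if y: "agree m x y" for y
  proof -
    have "S \<subseteq> {f \<in> E. \<forall>y\<in>{y}. \<iota> f y = y}"
      using n agree_mono[OF y m] SD derived_on_E by auto
    then have "K \<subseteq> {f \<in> E. \<forall>y\<in>{y}. \<iota> f y = y}"
      using homeo.generate_subgroup_incl[OF _ fixator_subgroup[OF E_subgroup order_refl]] S(3) by blast
    then show ?thesis using K(3) by (auto simp: moves_def)
  qed
  then show ?thesis by blast
qed

definition location :: "cantor \<Rightarrow> real option" where
  "location x = (if \<exists>p. located x p then Some (THE p. located x p) else None)"

lemma location_Some: "location x = Some p \<longleftrightarrow> located x p"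
proof -
  have "(THE p. located x p) = p" if "located x p" for p
    using that located_unique by blast
  then show ?thesis by (auto simp: location_def)
qed

lemma location_None: "location x = None \<longleftrightarrow> (\<forall>a b. a < b \<longrightarrow> \<not> moves x a b)"
proof
  assume "location x = None"
  then have "\<nexists>p. located x p" by (auto simp: location_def split: if_splits)
  then show "\<forall>a b. a < b \<longrightarrow> \<not> moves x a b" using located_exists by blast
next
  assume "\<forall>a b. a < b \<longrightarrow> \<not> moves x a b"
  then have "\<nexists>p. located x p" unfolding located_def by blast
  then show "location x = None" by (simp add: location_def)
qed

lemma location_equivariant:
  assumes "f \<in> E"
  shows "location (\<iota> f x) = map_option f (location x)"
proof (cases "location x")
  case None
  have "location (\<iota> f x) \<noteq> Some q" for q
    using located_equivariant[OF E_inv[OF assms], of "\<iota> f x" q] None assms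
    by (metis location_Some \<iota>_inv_f option.distinct(1))
  then show ?thesis using None by (cases "location (\<iota> f x)") auto
next
  case (Some p)
  then have "located (\<iota> f x) (f p)" by (intro located_equivariant[OF assms]) (simp only: location_Some)
  then have "location (\<iota> f x) = Some (f p)" by (simp only: location_Some)
  then show ?thesis using Some by simp
qed

lemma location_continuous:
  assumes "FG_filtered E"
  shows "continuous_map euclidean circle location"
  unfolding continuous_map_def
proof (intro conjI allI impI)
  show "location \<in> topspace euclidean \<rightarrow> topspace circle"
    using not_None_eq by (auto simp: image_iff)
  fix U assume U: "openin circle U"
  have near: "\<exists>n. \<forall>y. agree n x y \<longrightarrow> location y \<in> Some ` V"
    if V: "open V" "p \<in> V" "location x = Some p" for x p V
  proof -
    obtain a b where ab: "a < p" "p < b" "{a..b} \<subseteq> V" using open_contains_interval V by blast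
    have "located x p" using V(3) location_Some by simp
    then obtain n where n: "\<And>y. agree n x y \<Longrightarrow> \<exists>q. located y q \<and> a \<le> q \<and> q \<le> b"
      using located_nearby ab by blast
    have "location y \<in> Some ` V" if y: "agree n x y" for y
    proof -
      obtain q where "located y q" "a \<le> q" "q \<le> b" using n[OF y] by blast
      then have "location y = Some q" "q \<in> V" using ab(3) location_Some by auto
      then show ?thesis by simp
    qed
    then show ?thesis by blast
  qed
  have "open {x. location x \<in> U}"
  proof (rule open_if_cylinders)
    fix x assume x: "x \<in> {x. location x \<in> U}"
    show "\<exists>n. \<forall>y. agree n x y \<longrightarrow> y \<in> {x. location x \<in> U}"
    proof (cases "location x")
      case (Some p)
      have "\<exists>V. open V \<and> p \<in> V \<and> Some ` V \<subseteq> U"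
        using U x Some by (auto simp: openin_Alexandroff_compactification closed_def)
      then obtain V where V: "open V" "p \<in> V" "Some ` V \<subseteq> U" by blast
      obtain n where "\<And>y. agree n x y \<Longrightarrow> location y \<in> Some ` V"
        using near[OF V(1,2) Some] by blast
      then have "\<forall>y. agree n x y \<longrightarrow> y \<in> {x. location x \<in> U}" using V(3) by auto
      then show ?thesis by (rule exI)
    next
      case None
      then obtain C where C: "compact C" "U = insert None (Some ` (- C))"
        using U x by (auto simp: openin_Alexandroff_compactification Compl_eq_Diff_UNIV)
      obtain r where r: "0 < r" "C \<subseteq> {-r<..<r}" using bounded_by_interval[OF C(1)] .
      have um: "\<And>a b. a < b \<Longrightarrow> \<not> moves x a b" using None location_None by blast
      obtain n where n: "\<And>y. agree n x y \<Longrightarrow> \<not> moves y (-r) r"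
        using unmoved_nearby[OF assms um, of "-r" r] r by auto
      have "location y \<in> U" if y: "agree n x y" for y
      proof (cases "location y")
        case (Some q)
        then have "q \<notin> {-r<..<r}" using n[OF y] located_moves location_Some by auto
        then show ?thesis using Some C(2) r(2) by auto
      qed (simp add: C(2))
      then show ?thesis by blast
    qed
  qed
  then show "openin euclidean {x \<in> topspace euclidean. location x \<in> U}" by simp
qed

lemma ex_located: "\<exists>x p. located x p"
proof -
  obtain f where f: "f \<in> derived_on 0 1" "f (1/2) \<noteq> 1/2" using derived_on_moves[of 0 "1/2" 1] by auto
  have "\<iota> f \<noteq> \<iota> id"
    using \<iota>_mon derived_on_E[OF f(1)] E_id f(2) by (auto simp: mon_def inj_on_def)
  then obtain x where "\<iota> f x \<noteq> x" by (auto simp: \<iota>_id fun_eq_iff)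
  then show ?thesis using located_exists[of 0 1 x] f by (auto simp: moves_def)
qed

text \<open>The image is closed because the Cantor space is compact. A nonempty open set missing it would contain
  a point of the \<open>E\<close>-orbit of a real point \<open>p\<close> of the image, since such an orbit is dense and unbounded.\<close>

lemma location_surj:
  assumes "FG_filtered E"
  shows "location ` UNIV = topspace circle"
proof -
  have "compactin circle (location ` UNIV)"
    using image_compactin[OF _ location_continuous[OF assms], of UNIV] compact_cantor by simp
  moreover have "Hausdorff_space circle"
    by (simp add: Hausdorff_space_Alexandroff_compactification locally_compact_space_euclidean)
  ultimately have "closedin circle (location ` UNIV)" using compactin_imp_closedin by blast
  then have U: "openin circle (topspace circle - location ` UNIV)" by (simp add: closedin_def)
  obtain x p where xp: "located x p" using ex_located by blast
  have orbit: "Some (f p) \<in> location ` UNIV" if "f \<in> E" for f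
    using located_equivariant[OF that xp] location_Some by (metis rangeI)
  have "topspace circle - location ` UNIV = {}"
    using U unfolding openin_Alexandroff_compactification
  proof (elim disjE exE conjE)
    fix V :: "real set" assume V: "openin euclidean V" "topspace circle - location ` UNIV = Some ` V"
    have "q \<notin> V" for q
    proof
      assume "q \<in> V"
      then obtain a b where ab: "a < q" "q < b" "{a..b} \<subseteq> V"
        using open_contains_interval V(1) by (metis open_openin)
      have "min a p - 1 < a" "a < b" "b < max b p + 1" "min a p - 1 < p" "p < max b p + 1"
        using ab by linarith+
      then obtain t where t: "t \<in> derived_on (min a p - 1) (max b p + 1)" "a < t p" "t p < b"
        using derived_on_compress[of "min a p - 1" a b "max b p + 1" p p] by blast
      then have "t p \<in> V" using ab(3) by (auto simp: subset_eq)
      then have "Some (t p) \<in> topspace circle - location ` UNIV" unfolding V(2) by (rule imageI)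
      then show False using orbit derived_on_E t(1) by blast
    qed
    then show ?thesis using V(2) by auto
  next
    fix C :: "real set"
    assume C: "compactin euclidean C"
      "topspace circle - location ` UNIV = insert None (Some ` (topspace euclidean - C))"
    obtain r where r: "0 < r" "C \<subseteq> {-r<..<r}" using bounded_by_interval C(1) by auto
    have "p - 1 < p" "p < max p r + 1" "r < max p r + 1" by linarith+
    then obtain t where t: "t \<in> derived_on (p - 1) (max p r + 1)" "r < t p"
      using derived_on_up[of "p - 1" p "max p r + 1" r] by blast
    then have "t p \<in> topspace euclidean - C" using r by auto
    then have "Some (t p) \<in> topspace circle - location ` UNIV" unfolding C(2) by blast
    then show ?thesis using orbit derived_on_E t(1) by blast
  qed
  moreover have "location ` UNIV \<subseteq> topspace circle"
    using continuous_map_image_subset_topspace[OF location_continuous[OF assms]] by simp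
  ultimately show ?thesis by blast
qed

end

theorem theoremB:
  fixes E :: "(real \<Rightarrow> real) set" and \<iota> :: "(real \<Rightarrow> real) \<Rightarrow> (cantor \<Rightarrow> cantor)"
  assumes "subgroup E homeo_plus_real"
    and "finitely_generated_subgroup homeo_plus_real E"
    and "locally_moving E"
    and "abelian_germs E"
    and "FG_filtered E"
    and "\<iota> \<in> mon (homeo_plus_real\<lparr>carrier := E\<rparr>) thompson_V"
  shows "\<exists>\<phi> :: cantor \<Rightarrow> real option.
           continuous_map euclidean circle \<phi> \<and>
           \<phi> ` UNIV = topspace circle \<and>
           (\<forall>f \<in> E. \<forall>\<kappa>. \<phi> (\<iota> f \<kappa>) = map_option f (\<phi> \<kappa>))"
proof -
  interpret thompson_action E \<iota>
    by (intro thompson_action.intro locally_moving_group.intro thompson_action_axioms.intro)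
      (fact assms)+
  show ?thesis
    using location_continuous location_surj location_equivariant assms(5) by blast
qed

end
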